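(* Let $\Gamma$ be a Feynman graph with vertices $x_1,\dots,x_n$, loop edges $q_1,\dots,q_s$ and non-loop edges $q_{s+1},\dots,q_r$. Fix a multidegree $\underline a\in\mathbb N^r$ with $a_k>0$ for all $k\le s$, an order $\Omega$ of the vertices, and integers $l_1,\dots,l_n$. For $k>s$ write $x_{k^1},x_{k^2}$ for the two vertices adjacent to $q_k$, with $x_{k^1}<x_{k^2}$ in $\Omega$. There is a bijection between $(l_1,\dots,l_n)$-leaky graph covers of type $\Gamma$, order $\Omega$ and multidegree $\underline a$, and tuples $$\bigg((w_k)_{k=1,\dots,s},\ \Big(\Big(a_k,\ w_k\cdot\Big(\frac{x_{k^i}}{x_{k^j}}\Big)^{w_k}\Big)\Big)_{k=s+1,\dots,r}\bigg)$$ with positive integers $w_k$, where (for each $k>s$) $i=1$ and $j=2$ if $a_k=0$, and $\{i,j\}=\{1,2\}$ otherwise; where $w_k$ divides $a_k$ if $a_k\ne0$; and where the product of the fractions $\prod_{k>s}(x_{k^i}/x_{k^j})^{w_k}$ has exponent $l_m$ in $x_m$ for every $m=1,\dots,n$. Moreover, the weighted count of graph covers equals the $q_1^{a_1}\cdots q_r^{a_r}$-coefficient of the refined Feynman integral: $$N^{l_1,\dots,l_n}_{\Gamma,\underline a,\Omega}=\mathrm{coef}_{[q_1^{a_1}\cdots q_r^{a_r}]}\,I^{l_1,\dots,l_n}_{\Gamma,\Omega}(q_1,\dots,q_r).$$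
   Context: $\mathbb N=\{0,1,2,\dots\}$. FEYNMAN GRAPHS. A Feynman graph $\Gamma$ is a connected (non-metrized) multigraph without ends, with $n>1$ vertices labeled $x_1,\dots,x_n$ and edges labeled $q_1,\dots,q_r$, where by convention $q_1,\dots,q_s$ are the loop edges and $q_{s+1},\dots,q_r$ the non-loop edges. An order $\Omega$ of the vertices is a total ordering, viewed as a permutation: $\Omega(i)$ is the place that $x_i$ takes in the order. REFINED FEYNMAN INTEGRAL. Let $$P(x,q)=\sum_{w\ge1}w\,x^w+\sum_{a\ge1}\Big(\sum_{w|a}w\,(x^w+x^{-w})\Big)q^a,\qquad P^{\mathrm{loop}}(q)=\sum_{a\ge1}\Big(\sum_{w|a}w\Big)q^a,$$ and $$I^{l_1,\dots,l_n}_{\Gamma,\Omega}(q_1,\dots,q_r)=\mathrm{coef}_{[x_1^{l_1}\cdots x_n^{l_n}]}\ \prod_{k=1}^sP^{\mathrm{loop}}(q_k)\prod_{k=s+1}^rP\Big(\frac{x_{k^1}}{x_{k^2}},q_k\Big).$$ GRAPH COVERS. $E_{\mathbb T}$ is a circle of fixed length with a fixed orientation, and $p_0,p_1,\dots,p_n\in E_{\mathbb T}$ are distinct points ordered in this way when going around $E_{\mathbb T}$ in the orientation starting at $p_0$. A graph cover of type $\Gamma$, order $\Omega$ and multidegree $\underline a$, leaky with respect to $(l_1,\dots,l_n)$, is a surjective map $\pi:\Gamma'\to E_{\mathbb T}$, where $\Gamma'$ is a metrization of $\Gamma$ (keeping the vertex and edge labels), such that: (1) $\pi$ is piecewise integer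 affine linear, with a positive integer slope $\omega(q_k)$ (the expansion factor) on each edge $q_k$ (so $\pi$ is locally injective on each edge); (2) $\pi^{-1}(p_{\Omega(i)})$ contains $x_i$ for each $i$ (hence exactly one vertex of $\Gamma'$ lies over each $p_j$, $j=1,\dots,n$); (3) (leaky balancing) for each vertex $x_i$, if $f_1$ and $f_2$ are the flags of $E_{\mathbb T}$ at $p_{\Omega(i)}$ before and after $p_{\Omega(i)}$ in the orientation, then $\sum_{f'\mapsto f_1}\omega(f')=\sum_{f''\mapsto f_2}\omega(f'')-l_i$, the sums over flags of $\Gamma'$ at $x_i$ (outgoing minus incoming expansion factors equals $l_i$); (4) $|\pi^{-1}(p_0)\cap q_k|\cdot\omega(q_k)=a_k$ for all $k=1,\dots,r$. Graph covers are considered up to isomorphism respecting all labels. $N^{l_1,\dots,l_n}_{\Gamma,\underline a,\Omega}$ is the number of such graph covers, each counted with the product $\prod_{k=1}^r\omega(q_k)$ of the expansion factors of its edges.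
   Formalization: Surjectivity of covers can fail (one edge, a=0, l=(1,-1)), so the claim for surjective covers is stated only if there are no tuples or every arc of the circle has positive weighted degree; for maps satisfying (1)-(4) without surjectivity it is stated for all a, Ω, l. *)

theory Defs
  imports
    Complex_Main
    "HOL-Library.FuncSet"
    "HOL-Library.Poly_Mapping"
    "HOL-Library.Product_Plus"
    "HOL-Combinatorics.Permutations"
    "HOL-Computational_Algebra.Formal_Laurent_Series"
    "HOL-Analysis.Elementary_Metric_Spaces"
    "Graph_Theory.Digraph_Component"
begin

section \<open>Feynman graphs\<close>

text \<open>
  A multigraph is represented by a multi-digraph. The direction from tail to head of an arc is
  only a choice of parametrization of the undirected edge (the metric edge \<open>q\<^sub>k\<close> will
  be parametrized by an interval \<open>[0, \<ell>\<^sub>k]\<close>); the map to the circle may run along it in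
  either direction. The vertex \<open>x\<^sub>i\<close> is the number \<open>i\<close>, the edge \<open>q\<^sub>k\<close> the number \<open>k\<close>.
  \<^const>\<open>Digraph_Component.connected\<close> refers to the underlying undirected graph.
\<close>

definition loop_edges :: "(nat, nat) pre_digraph \<Rightarrow> nat set" where
  "loop_edges G = {k \<in> arcs G. tail G k = head G k}"

definition nonloop_edges :: "(nat, nat) pre_digraph \<Rightarrow> nat set" where
  "nonloop_edges G = {k \<in> arcs G. tail G k \<noteq> head G k}"

definition feynman_graph :: "nat \<Rightarrow> nat \<Rightarrow> nat \<Rightarrow> (nat, nat) pre_digraph \<Rightarrow> bool" where
  "feynman_graph n s r G \<longleftrightarrow>
     n > 1 \<and> s \<le> r \<and> verts G = {1..n} \<and> arcs G = {1..r} \<and>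
     wf_digraph G \<and> Digraph_Component.connected G \<and>
     loop_edges G = {1..s} \<and> nonloop_edges G = {s+1..r}"

text \<open>For a non-loop edge, the indices \<open>k\<^sup>1\<close> and \<open>k\<^sup>2\<close> of its smaller and larger vertex
  in the order \<open>\<Omega>\<close>.\<close>

definition lower_end :: "(nat, nat) pre_digraph \<Rightarrow> (nat \<Rightarrow> nat) \<Rightarrow> nat \<Rightarrow> nat" where
  "lower_end G \<Omega> k = (if \<Omega> (tail G k) < \<Omega> (head G k) then tail G k else head G k)"

definition upper_end :: "(nat, nat) pre_digraph \<Rightarrow> (nat \<Rightarrow> nat) \<Rightarrow> nat \<Rightarrow> nat" where
  "upper_end G \<Omega> k = (if \<Omega> (tail G k) < \<Omega> (head G k) then head G k else tail G k)"


section \<open>The refined Feynman integral\<close>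

definition propagator :: "int fls fps" where
  "propagator = Abs_fps (\<lambda>a.
     if a = 0 then fps_to_fls (Abs_fps (\<lambda>w. int w))
     else (\<Sum>w | w dvd a. of_nat w * (fls_X_intpow (int w) + fls_X_intpow (- int w))))"

definition loop_propagator :: "int fps" where
  "loop_propagator = Abs_fps (\<lambda>a. if a = 0 then 0 else (\<Sum>w | w dvd a. int w))"

text \<open>
  A formal series in the variables \<open>x\<^sub>i\<close> (integer exponents) and \<open>q\<^sub>k\<close> (natural exponents) is
  given by its coefficient function on exponent vectors.
\<close>

type_synonym exponent = "(nat \<Rightarrow>\<^sub>0 int) \<times> (nat \<Rightarrow>\<^sub>0 nat)"
type_synonym series = "exponent \<Rightarrow> int"

text \<open>
  Product of finitely many such series: the coefficient at \<open>m\<close> collects all ways of choosing one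
  monomial from every factor such that the exponents add up to \<open>m\<close>. For general series this may
  be an infinite sum; for the product of propagators below only finitely many choices contribute:
  the exponents of the \<open>q\<^sub>k\<close> are prescribed, and for the edges with \<open>q\<close>-exponent \<open>0\<close> only
  positive powers of \<open>x\<^sub>i / x\<^sub>j\<close> with \<open>x\<^sub>i\<close> before \<open>x\<^sub>j\<close> in \<open>\<Omega>\<close> occur.
\<close>

definition series_prod :: "nat set \<Rightarrow> (nat \<Rightarrow> series) \<Rightarrow> series" where
  "series_prod K F m =
     (\<Sum>M | M \<in> K \<rightarrow>\<^sub>E UNIV \<and> (\<Sum>k\<in>K. M k) = m \<and> (\<Prod>k\<in>K. F k (M k)) \<noteq> 0. \<Prod>k\<in>K. F k (M k))"

text \<open>\<open>P(x\<^sub>u / x\<^sub>v, q\<^sub>k)\<close> for \<open>u \<noteq> v\<close>, and \<open>P\<^sup>l\<^sup>o\<^sup>o\<^sup>p(q\<^sub>k)\<close>; each sum has at most one summand.\<close>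

definition subst_propagator :: "nat \<Rightarrow> nat \<Rightarrow> nat \<Rightarrow> series" where
  "subst_propagator u v k m =
     (\<Sum>(j, a) | m = (Poly_Mapping.single u j - Poly_Mapping.single v j, Poly_Mapping.single k a).
        fls_nth (fps_nth propagator a) j)"

definition subst_loop_propagator :: "nat \<Rightarrow> series" where
  "subst_loop_propagator k m =
     (\<Sum>a | m = (0, Poly_Mapping.single k a). fps_nth loop_propagator a)"

definition edge_series :: "(nat, nat) pre_digraph \<Rightarrow> (nat \<Rightarrow> nat) \<Rightarrow> nat \<Rightarrow> series" where
  "edge_series G \<Omega> k =
     (if k \<in> loop_edges G then subst_loop_propagator k
      else subst_propagator (lower_end G \<Omega> k) (upper_end G \<Omega> k) k)"

definition exponents :: "nat set \<Rightarrow> (nat \<Rightarrow> 'a) \<Rightarrow> (nat \<Rightarrow>\<^sub>0 'a::comm_monoid_add)" where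
  "exponents I e = (\<Sum>i\<in>I. Poly_Mapping.single i (e i))"

definition feynman_integral ::
  "(nat, nat) pre_digraph \<Rightarrow> (nat \<Rightarrow> nat) \<Rightarrow> (nat \<Rightarrow> int) \<Rightarrow> (nat \<Rightarrow>\<^sub>0 nat) \<Rightarrow> int" where
  "feynman_integral G \<Omega> l = (\<lambda>b. series_prod (arcs G) (edge_series G \<Omega>) (exponents (verts G) l, b))"


section \<open>The circle\<close>

text \<open>The circle of length \<open>L\<close>, oriented counterclockwise, with its parametrization by arc length.\<close>

definition circle :: "real \<Rightarrow> complex set" where
  "circle L = sphere 0 (L / (2 * pi))"

definition arc_param :: "real \<Rightarrow> real \<Rightarrow> complex" where
  "arc_param L x = complex_of_real (L / (2 * pi)) * cis (2 * pi * x / L)"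

definition cyclically_ordered :: "real \<Rightarrow> nat \<Rightarrow> (nat \<Rightarrow> complex) \<Rightarrow> bool" where
  "cyclically_ordered L n p \<longleftrightarrow>
     (\<exists>x. (\<forall>j<n. x j < x (Suc j)) \<and> x n < x 0 + L \<and> (\<forall>j\<le>n. p j = arc_param L (x j)))"


section \<open>Leaky graph covers\<close>

text \<open>
  A metrization of \<open>G\<close> assigns a positive length to each edge. The points of the resulting metric
  graph are the vertices and the interior points of the edges.
\<close>

datatype point = Vertex nat | Inner nat real

definition points :: "(nat, nat) pre_digraph \<Rightarrow> (nat \<Rightarrow> real) \<Rightarrow> point set" where
  "points G len = Vertex ` verts G \<union> {Inner k t | k t. k \<in> arcs G \<and> 0 < t \<and> t < len k}"

definition edge_point :: "(nat, nat) pre_digraph \<Rightarrow> (nat \<Rightarrow> real) \<Rightarrow> nat \<Rightarrow> real \<Rightarrow> point" where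
  "edge_point G len k t =
     (if t = 0 then Vertex (tail G k) else if t = len k then Vertex (head G k) else Inner k t)"

text \<open>A flag is an edge together with one of its two ends (\<open>False\<close>: the tail end, \<open>True\<close>: the head
  end); \<open>flag_point\<close> travels along the edge away from that end. A loop edge has two flags at its
  vertex.\<close>

type_synonym flag = "nat \<times> bool"

definition flags_at :: "(nat, nat) pre_digraph \<Rightarrow> nat \<Rightarrow> flag set" where
  "flags_at G i =
     {(k, False) | k. k \<in> arcs G \<and> tail G k = i} \<union> {(k, True) | k. k \<in> arcs G \<and> head G k = i}"

fun flag_point :: "(nat, nat) pre_digraph \<Rightarrow> (nat \<Rightarrow> real) \<Rightarrow> flag \<Rightarrow> real \<Rightarrow> point" where
  "flag_point G len (k, at_head) t = edge_point G len k (if at_head then len k - t else t)"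

record graph_map =
  edge_length :: "nat \<Rightarrow> real"
  cover_map :: "point \<Rightarrow> complex"

text \<open>The map is affine linear along the edge of the flag, with slope \<open>m\<close> with respect to the
  orientation of the circle: \<open>m > 0\<close> means that the flag is mapped to the flag of the circle after
  the image of its vertex, \<open>m < 0\<close> that it is mapped to the flag before it.\<close>

definition has_slope :: "real \<Rightarrow> (nat, nat) pre_digraph \<Rightarrow> graph_map \<Rightarrow> flag \<Rightarrow> int \<Rightarrow> bool" where
  "has_slope L G C f m \<longleftrightarrow>
     (\<exists>x. \<forall>t\<in>{0..edge_length C (fst f)}.
        cover_map C (flag_point G (edge_length C) f t) = arc_param L (x + of_int m * t))"

definition slope :: "real \<Rightarrow> (nat, nat) pre_digraph \<Rightarrow> graph_map \<Rightarrow> flag \<Rightarrow> int" where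
  "slope L G C f = (THE m. has_slope L G C f m)"

definition flag_expansion :: "real \<Rightarrow> (nat, nat) pre_digraph \<Rightarrow> graph_map \<Rightarrow> flag \<Rightarrow> nat" where
  "flag_expansion L G C f = nat \<bar>slope L G C f\<bar>"

definition expansion :: "real \<Rightarrow> (nat, nat) pre_digraph \<Rightarrow> graph_map \<Rightarrow> nat \<Rightarrow> nat" where
  "expansion L G C k = flag_expansion L G C (k, False)"

text \<open>
  All conditions on a graph cover except surjectivity. A map satisfying them is surjective if and
  only if the numbers \<open>arc_degree\<close> below are positive. This is not automatic: for a single edge with
  leaks \<open>1\<close> and \<open>- 1\<close> at its two ends and multidegree \<open>0\<close>, the image is a proper arc, although the
  coefficient of the Feynman integral is \<open>1\<close>.
\<close>

definition leaky_maps ::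
  "real \<Rightarrow> (nat \<Rightarrow> complex) \<Rightarrow> (nat, nat) pre_digraph \<Rightarrow> (nat \<Rightarrow> nat) \<Rightarrow> (nat \<Rightarrow> nat) \<Rightarrow> (nat \<Rightarrow> int)
     \<Rightarrow> graph_map set" where
  "leaky_maps L p G \<Omega> a l = {C.
     (\<forall>k\<in>arcs G. edge_length C k > 0) \<and>
     cover_map C ` points G (edge_length C) \<subseteq> circle L \<and>
     (\<forall>k\<in>arcs G. \<exists>m. m \<noteq> 0 \<and> has_slope L G C (k, False) m) \<and>
     (\<forall>i\<in>verts G. cover_map C (Vertex i) = p (\<Omega> i)) \<and>
     (\<forall>i\<in>verts G.
        (\<Sum>f | f \<in> flags_at G i \<and> slope L G C f < 0. int (flag_expansion L G C f)) =
        (\<Sum>f | f \<in> flags_at G i \<and> slope L G C f > 0. int (flag_expansion L G C f)) - l i) \<and>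
     (\<forall>k\<in>arcs G.
        card {x \<in> edge_point G (edge_length C) k ` {0..edge_length C k}. cover_map C x = p 0}
          * expansion L G C k = a k)}"

definition graph_covers ::
  "real \<Rightarrow> (nat \<Rightarrow> complex) \<Rightarrow> (nat, nat) pre_digraph \<Rightarrow> (nat \<Rightarrow> nat) \<Rightarrow> (nat \<Rightarrow> nat) \<Rightarrow> (nat \<Rightarrow> int)
     \<Rightarrow> graph_map set" where
  "graph_covers L p G \<Omega> a l =
     {C \<in> leaky_maps L p G \<Omega> a l. cover_map C ` points G (edge_length C) = circle L}"

text \<open>Isomorphisms are isometries of the metric graphs over the circle that fix the labels of
  vertices and edges. The second alternative (reversing an edge) is only possible for loop edges,
  where the choice of parametrization is not determined by the labels.\<close>

definition isomorphic :: "(nat, nat) pre_digraph \<Rightarrow> graph_map \<Rightarrow> graph_map \<Rightarrow> bool" where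
  "isomorphic G C D \<longleftrightarrow>
     (\<exists>\<phi>. bij_betw \<phi> (points G (edge_length C)) (points G (edge_length D)) \<and>
       (\<forall>i\<in>verts G. \<phi> (Vertex i) = Vertex i) \<and>
       (\<forall>k\<in>arcs G. edge_length C k = edge_length D k \<and>
          ((\<forall>t\<in>{0..edge_length C k}.
              \<phi> (edge_point G (edge_length C) k t) = edge_point G (edge_length D) k t) \<or>
           (\<forall>t\<in>{0..edge_length C k}.
              \<phi> (edge_point G (edge_length C) k t)
                = edge_point G (edge_length D) k (edge_length D k - t)))) \<and>
       (\<forall>x\<in>points G (edge_length C). cover_map D (\<phi> x) = cover_map C x))"

definition iso_rel :: "(nat, nat) pre_digraph \<Rightarrow> graph_map set \<Rightarrow> (graph_map \<times> graph_map) set" where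
  "iso_rel G S = {(C, D). C \<in> S \<and> D \<in> S \<and> isomorphic G C D}"

definition iso_classes :: "(nat, nat) pre_digraph \<Rightarrow> graph_map set \<Rightarrow> graph_map set set" where
  "iso_classes G S = S // iso_rel G S"

text \<open>The weight is constant on isomorphism classes.\<close>

definition weighted_count :: "real \<Rightarrow> (nat, nat) pre_digraph \<Rightarrow> graph_map set \<Rightarrow> nat" where
  "weighted_count L G S =
     (\<Sum>c\<in>iso_classes G S. the_elem ((\<lambda>C. \<Prod>k\<in>arcs G. expansion L G C k) ` c))"


section \<open>Tuples\<close>

text \<open>Laurent polynomials in the \<open>x\<^sub>i\<close> with integer coefficients.\<close>

type_synonym laurent = "(nat \<Rightarrow>\<^sub>0 int) \<Rightarrow>\<^sub>0 int"

definition x_fraction :: "nat \<Rightarrow> nat \<Rightarrow> laurent" where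
  "x_fraction i j = Poly_Mapping.single (Poly_Mapping.single i 1 - Poly_Mapping.single j 1) 1"

definition x_monomial :: "nat set \<Rightarrow> (nat \<Rightarrow> int) \<Rightarrow> laurent" where
  "x_monomial V l = Poly_Mapping.single (exponents V l) 1"

definition make_tuple ::
  "(nat, nat) pre_digraph \<Rightarrow> (nat \<Rightarrow> nat) \<Rightarrow> (nat \<Rightarrow> nat) \<Rightarrow> (nat \<Rightarrow> nat) \<Rightarrow> (nat \<Rightarrow> nat)
     \<Rightarrow> (nat \<Rightarrow> nat) \<times> (nat \<Rightarrow> nat \<times> laurent)" where
  "make_tuple G a w u v =
     (restrict w (loop_edges G),
      \<lambda>k\<in>nonloop_edges G. (a k, of_nat (w k) * x_fraction (u k) (v k) ^ w k))"

definition tuples ::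
  "(nat, nat) pre_digraph \<Rightarrow> (nat \<Rightarrow> nat) \<Rightarrow> (nat \<Rightarrow> nat) \<Rightarrow> (nat \<Rightarrow> int)
     \<Rightarrow> ((nat \<Rightarrow> nat) \<times> (nat \<Rightarrow> nat \<times> laurent)) set" where
  "tuples G \<Omega> a l = {make_tuple G a w u v | w u v.
     (\<forall>k\<in>arcs G. w k > 0 \<and> (a k \<noteq> 0 \<longrightarrow> w k dvd a k)) \<and>
     (\<forall>k\<in>nonloop_edges G.
        if a k = 0 then u k = lower_end G \<Omega> k \<and> v k = upper_end G \<Omega> k
        else {u k, v k} = {lower_end G \<Omega> k, upper_end G \<Omega> k}) \<and>
     (\<Prod>k\<in>nonloop_edges G. x_fraction (u k) (v k) ^ w k) = x_monomial (verts G) l}"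

text \<open>The tuple of a cover: its expansion factors, with the fractions given by the start and the
  end of each edge when traversed in the direction of the orientation of the circle.\<close>

definition cover_tuple ::
  "real \<Rightarrow> (nat, nat) pre_digraph \<Rightarrow> (nat \<Rightarrow> nat) \<Rightarrow> graph_map
     \<Rightarrow> (nat \<Rightarrow> nat) \<times> (nat \<Rightarrow> nat \<times> laurent)" where
  "cover_tuple L G a C = make_tuple G a (expansion L G C)
     (\<lambda>k. if slope L G C (k, False) > 0 then tail G k else head G k)
     (\<lambda>k. if slope L G C (k, False) > 0 then head G k else tail G k)"

text \<open>
  By the leaky balancing condition, the weighted number of preimages of any point of the open arc
  after \<open>p\<^sub>j\<close> is the following number. Hence whether a leaky map is surjective is determined by the
  multidegree, the order and the leaks.
\<close>

definition arc_degree ::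
  "(nat, nat) pre_digraph \<Rightarrow> (nat \<Rightarrow> nat) \<Rightarrow> (nat \<Rightarrow> nat) \<Rightarrow> (nat \<Rightarrow> int) \<Rightarrow> nat \<Rightarrow> int" where
  "arc_degree G \<Omega> a l j = (\<Sum>k\<in>arcs G. int (a k)) + (\<Sum>i | i \<in> verts G \<and> \<Omega> i \<le> j. l i)"

end

(* Lift the circle to the line. A leaky map sends an edge k to an affine path that starts at the
   prescribed image of its tail, so it is determined by the integer slopes m(k) along the directed
   edges and the edge lengths. Counting lifts of p_0 on such a path shows that the multidegree fixes
   the length, once m(k) divides a(k), and that a positive length exists unless a(k) = 0 and the path
   would descend in the order. Hence isomorphism classes correspond to integer functions m with these
   divisibility and order constraints that satisfy the leaky balancing condition, with m(k) taken up to
   sign on loops. The tuples encode the same functions, and expanding the product of propagators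
   edge by edge sums the product of the |m(k)| over them. *)

theory Submission
  imports Defs
begin

section \<open>Lifting to the line\<close>

text \<open>A single signed integer per edge carries direction (its sign) and expansion factor (its
  absolute value). Balancing then becomes linear in the slopes and turns into one equation of
  exponent vectors, shared by covers, tuples and integral. Lifting all vertices into the open
  interval from \<open>X 0\<close> to \<open>X 0 + L\<close> keeps the count over p_0 free of
  boundary terms. Three points resist an edge-by-edge treatment. The slope of a loop does not enter
  balancing and its sign is not an isomorphism invariant. An edge with \<open>a k = 0\<close> and
  distinct ends has infinitely many candidate slopes, so finiteness has to come from balancing on
  the whole graph. Finally, surjectivity does not follow from the other conditions; but the weighted
  number of preimages over an arc depends only on the multidegree, the order and the leaks, so that
  positivity of these numbers makes every leaky map a graph cover.\<close>

lemma arc_param_eq_iff: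
  assumes "L > 0"
  shows "arc_param L x = arc_param L y \<longleftrightarrow> (\<exists>N::int. x = y + L * N)"
proof -
  have "arc_param L x = arc_param L y \<longleftrightarrow> cis (2 * pi * x / L) = cis (2 * pi * y / L)"
    using assms by (simp add: arc_param_def)
  also have "\<dots> \<longleftrightarrow> (\<exists>N::int. 2 * pi * x / L = 2 * pi * y / L + 2 * pi * N)"
    using sin_cos_eq_iff by (auto simp: complex_eq_iff)
  also have "\<dots> \<longleftrightarrow> (\<exists>N::int. x = y + L * N)"
  proof -
    have "2 * pi * x / L = 2 * pi * y / L + 2 * pi * N \<longleftrightarrow> x = y + L * N" for N :: int
    proof -
      have "2 * pi * x / L = 2 * pi * y / L + 2 * pi * N \<longleftrightarrow> 2 * pi * (x - (y + L * N)) = 0"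
        using assms by (simp add: field_simps)
      then show ?thesis by simp
    qed
    then show ?thesis by simp
  qed
  finally show ?thesis .
qed

lemma arc_param_shift: "L > 0 \<Longrightarrow> arc_param L (x + L * of_int N) = arc_param L x"
  by (subst arc_param_eq_iff) auto

lemma arc_param_in_circle: "L > 0 \<Longrightarrow> arc_param L x \<in> circle L"
  by (simp add: arc_param_def circle_def norm_mult norm_divide)

lemma circle_arc_paramE:
  assumes "L > 0" "z \<in> circle L"
  obtains x where "x0 \<le> x" "x < x0 + L" "z = arc_param L x"
proof -
  define y where "y = L * Arg z / (2 * pi)"
  have "norm z = L / (2 * pi)" using assms by (simp add: circle_def)
  then have z: "z = arc_param L y"
    using rcis_cmod_Arg[of z] assms(1) by (simp add: arc_param_def y_def rcis_def)
  define N where "N = \<lfloor>(y - x0) / L\<rfloor>"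
  have "of_int N \<le> (y - x0) / L" "(y - x0) / L < of_int N + 1"
    unfolding N_def by linarith+
  then have "x0 \<le> y - L * N" "y - L * N < x0 + L"
    using assms(1) by (auto simp: field_simps)
  moreover have "z = arc_param L (y - L * N)"
    using arc_param_shift[OF assms(1), of "y - L * N" N] z by simp
  ultimately show ?thesis using that by blast
qed

text \<open>A nonconstant affine function would change by a nonzero amount of at most
  \<open>L / 2\<close> between 0 and a small \<open>e\<close>, while distinct multiples of
  \<open>L\<close> differ by at least \<open>L\<close>.\<close>

lemma affine_int_on_interval_const:
  fixes d c len L :: real
  assumes "L > 0" "len > 0" "\<And>t. t \<in> {0..len} \<Longrightarrow> \<exists>N::int. d + c * t = L * N"
  shows "c = 0"
proof (rule ccontr)
  assume c: "c \<noteq> 0"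
  define e where "e = min len (L / (2 * \<bar>c\<bar>))"
  have e: "0 < e" "e \<le> len" "e \<le> L / (2 * \<bar>c\<bar>)" using assms c by (auto simp: e_def)
  obtain N0 :: int where N0: "d = L * N0" using assms(3)[of 0] assms(2) by auto
  obtain N1 :: int where N1: "d + c * e = L * N1" using assms(3)[of e] e by auto
  have eq: "c * e = L * (N1 - N0)" using N0 N1 by (simp add: algebra_simps)
  have "\<bar>c\<bar> * e \<le> L / 2" using e(3) c by (simp add: field_simps)
  then have "\<bar>c * e\<bar> \<le> L / 2" using e(1) by (simp add: abs_mult)
  then have "L * \<bar>real_of_int (N1 - N0)\<bar> \<le> L * (1/2)" unfolding eq using assms(1) by (simp add: abs_mult)
  then have "\<bar>real_of_int (N1 - N0)\<bar> \<le> 1/2" using assms(1) by (subst (asm) mult_le_cancel_left_pos) auto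
  then have "N1 - N0 = 0" by linarith
  then show False using eq e c by simp
qed

text \<open>The difference of the two lifts is affine with values in the multiples of
  \<open>L\<close>. This uniqueness is what gives the definite description in \<open>slope\<close>
  its meaning.\<close>

lemma arc_param_slope_unique:
  assumes "L > 0" "len > 0"
    and "\<And>t. t \<in> {0..len} \<Longrightarrow> arc_param L (x + of_int m * t) = arc_param L (y + of_int m' * t)"
  shows "m = m'"
proof -
  have "real_of_int (m - m') = 0"
  proof (rule affine_int_on_interval_const[OF assms(1,2)])
    fix t assume "t \<in> {0..len}"
    from assms(3)[OF this] obtain N :: int where "x + m * t = y + m' * t + L * N"
      using arc_param_eq_iff[OF assms(1)] by auto
    then show "\<exists>N::int. (x - y) + real_of_int (m - m') * t = L * N"
      by (auto simp: algebra_simps)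
  qed
  then show ?thesis by simp
qed

text \<open>The lifted path climbs from \<open>\<alpha>\<close> to \<open>\<beta> + L * d\<close>.
  Since \<open>\<alpha>\<close> and \<open>\<beta>\<close> lie strictly between \<open>x0\<close>
  and \<open>x0 + L\<close>, the lifts \<open>x0 + L * N\<close> that it meets are exactly those
  with \<open>N\<close> from 1 to \<open>d\<close>, none of them at an end of the path.\<close>

lemma card_crossings_pos:
  fixes m :: int and L len x0 \<alpha> \<beta> :: real
  assumes L: "L > 0" and m: "m > 0" and len: "len > 0"
    and \<alpha>: "x0 < \<alpha>" "\<alpha> < x0 + L" and \<beta>: "x0 < \<beta>" "\<beta> < x0 + L"
    and ends: "arc_param L (\<alpha> + of_int m * len) = arc_param L \<beta>"
  shows "of_int m * len = \<beta> - \<alpha> + L * card {t \<in> {0..len}. arc_param L (\<alpha> + of_int m * t) = arc_param L x0}"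
proof -
  obtain d :: int where d: "\<alpha> + m * len = \<beta> + L * d"
    using ends arc_param_eq_iff[OF L] by auto
  have mlen: "m * len > 0" using m len by simp
  \<comment> \<open>The path ends at \<open>\<beta> + L * d\<close>, above
    \<open>\<alpha> > x0 > \<beta> - L\<close>.\<close>
  have "L * d > L * (-1)" using d mlen \<alpha> \<beta> by simp
  then have "real_of_int d > -1" using L by (subst (asm) mult_less_cancel_left_pos) auto
  then have d0: "d \<ge> 0" by linarith
  have "{t \<in> {0..len}. arc_param L (\<alpha> + of_int m * t) = arc_param L x0}
     = (\<lambda>N::int. (x0 + L * N - \<alpha>) / m) ` {1..d}" (is "?A = ?g ` _")
  proof (intro subset_antisym subsetI)
    fix t assume "t \<in> ?A"
    then obtain N :: int where t: "0 \<le> t" "t \<le> len" and N: "\<alpha> + m * t = x0 + L * N"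
      using arc_param_eq_iff[OF L] by auto
    have "0 \<le> m * t" "m * t \<le> m * len" using t m by auto
    then have "L * 0 < L * N" "L * N < L * (d + 1)" using N d \<alpha> \<beta> by (auto simp: algebra_simps)
    then have "0 < N" "real_of_int N < d + 1" using L by (simp_all add: mult_less_cancel_left_pos zero_less_mult_iff)
    then have "N \<in> {1..d}" by auto
    moreover have "t = ?g N" using N m by (simp add: field_simps)
    ultimately show "t \<in> ?g ` {1..d}" by blast
  next
    fix t assume "t \<in> ?g ` {1..d}"
    then obtain N :: int where N: "1 \<le> N" "N \<le> d" and t: "t = ?g N" by auto
    have eq: "\<alpha> + m * t = x0 + L * N" using t m by (simp add: field_simps)
    have "L * 1 \<le> L * N" "L * N \<le> L * d" using N L by auto
    then have "0 \<le> m * t" "m * t \<le> m * len" using eq d \<alpha> \<beta> by linarith+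
    then have "0 \<le> t" "t \<le> len" using m by (simp_all add: zero_le_mult_iff)
    then show "t \<in> ?A" using eq arc_param_eq_iff[OF L] by auto
  qed
  moreover have "inj_on ?g {1..d}" using L m by (auto simp: inj_on_def)
  ultimately have "card ?A = nat d" by (simp add: card_image)
  then show ?thesis using d d0 by simp
qed

text \<open>A path of negative slope is traversed backwards, which exchanges \<open>\<alpha>\<close>
  and \<open>\<beta>\<close> and leaves the number of crossings unchanged; \<open>sgn m\<close>
  records the exchange.\<close>

lemma card_crossings:
  fixes m :: int and L len x0 \<alpha> \<beta> :: real
  assumes L: "L > 0" and m: "m \<noteq> 0" and len: "len > 0"
    and \<alpha>: "x0 < \<alpha>" "\<alpha> < x0 + L" and \<beta>: "x0 < \<beta>" "\<beta> < x0 + L"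
    and ends: "arc_param L (\<alpha> + of_int m * len) = arc_param L \<beta>"
  shows "of_int \<bar>m\<bar> * len = of_int (sgn m) * (\<beta> - \<alpha>)
     + L * card {t \<in> {0..len}. arc_param L (\<alpha> + of_int m * t) = arc_param L x0}"
proof (cases "m > 0")
  case True
  then show ?thesis using card_crossings_pos[OF L _ len \<alpha> \<beta> ends] by simp
next
  case False
  then have m': "- m > 0" using m by simp
  obtain d :: int where d: "\<alpha> + m * len = \<beta> + L * d"
    using ends arc_param_eq_iff[OF L] by auto
  let ?A = "{t \<in> {0..len}. arc_param L (\<alpha> + of_int m * t) = arc_param L x0}"
  let ?B = "{t \<in> {0..len}. arc_param L (\<beta> + of_int (-m) * t) = arc_param L x0}"
  have rev: "arc_param L (\<beta> - of_int m * t) = arc_param L (\<alpha> + of_int m * (len - t))" for t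
  proof -
    have "\<alpha> + of_int m * (len - t) = \<beta> - of_int m * t + L * d" using d by (simp add: algebra_simps)
    then show ?thesis using arc_param_shift[OF L] by simp
  qed
  have "bij_betw (\<lambda>t. len - t) ?B ?A"
    by (rule bij_betwI[where g = "\<lambda>t. len - t"]) (auto simp: rev)
  then have "card ?B = card ?A" by (rule bij_betw_same_card)
  moreover have "arc_param L (\<beta> + of_int (- m) * len) = arc_param L \<alpha>" using rev[of len] by simp
  ultimately show ?thesis
    using card_crossings_pos[OF L m' len \<beta> \<alpha>] False m by simp
qed

section \<open>Leaky maps and their slopes\<close>

text \<open>The sign of \<open>m\<close> compares the parametrization from tail to head with the
  orientation of the circle.\<close>

definition edge_source :: "(nat, nat) pre_digraph \<Rightarrow> nat \<Rightarrow> int \<Rightarrow> nat" where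
  "edge_source G k m = (if m > 0 then tail G k else head G k)"

definition edge_target :: "(nat, nat) pre_digraph \<Rightarrow> nat \<Rightarrow> int \<Rightarrow> nat" where
  "edge_target G k m = (if m > 0 then head G k else tail G k)"

text \<open>These are the slopes for which a positive length exists. Divisibility makes
  \<open>a k / \<bar>m\<bar>\<close> a possible number of crossings; with no crossing, the image
  stays in the fundamental interval and must climb there. For a loop with \<open>a k = 0\<close> the
  set is empty.\<close>

definition valid_slopes ::
  "(nat, nat) pre_digraph \<Rightarrow> (nat \<Rightarrow> nat) \<Rightarrow> (nat \<Rightarrow> nat) \<Rightarrow> nat \<Rightarrow> int set" where
  "valid_slopes G \<Omega> a k = {m. m \<noteq> 0 \<and> m dvd int (a k) \<and>
     (a k = 0 \<longrightarrow> \<Omega> (edge_source G k m) < \<Omega> (edge_target G k m))}"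

text \<open>The net outflow of the signed slopes at each vertex is its leak. A loop enters both sums
  and cancels.\<close>

definition balanced :: "(nat, nat) pre_digraph \<Rightarrow> (nat \<Rightarrow> int) \<Rightarrow> (nat \<Rightarrow> int) \<Rightarrow> bool" where
  "balanced G l s \<longleftrightarrow> (\<forall>i\<in>verts G.
     (\<Sum>k | k \<in> arcs G \<and> tail G k = i. s k) - (\<Sum>k | k \<in> arcs G \<and> head G k = i. s k) = l i)"

lemma has_slope_reverse:
  assumes "has_slope L G C (k, False) m"
  shows "has_slope L G C (k, True) (- m)"
proof -
  from assms obtain x where
    x: "\<And>t. t \<in> {0..edge_length C k} \<Longrightarrow>
      cover_map C (edge_point G (edge_length C) k t) = arc_param L (x + of_int m * t)"
    by (auto simp: has_slope_def)
  show ?thesis unfolding has_slope_def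
  proof (intro exI ballI)
    fix t assume "t \<in> {0..edge_length C (fst (k, True))}"
    then show "cover_map C (flag_point G (edge_length C) (k, True) t)
      = arc_param L (x + of_int m * edge_length C k + of_int (- m) * t)"
      using x[of "edge_length C k - t"] by (simp add: algebra_simps)
  qed
qed

lemma slope_eqI:
  assumes "L > 0" "edge_length C (fst f) > 0" "has_slope L G C f m"
  shows "slope L G C f = m"
  unfolding slope_def
proof (rule the_equality[of "has_slope L G C f", OF assms(3)])
  fix m' assume "has_slope L G C f m'"
  then obtain y where "\<And>t. t \<in> {0..edge_length C (fst f)} \<Longrightarrow>
      cover_map C (flag_point G (edge_length C) f t) = arc_param L (y + of_int m' * t)"
    unfolding has_slope_def by blast
  moreover obtain x where "\<And>t. t \<in> {0..edge_length C (fst f)} \<Longrightarrow>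
      cover_map C (flag_point G (edge_length C) f t) = arc_param L (x + of_int m * t)"
    using assms(3) unfolding has_slope_def by blast
  ultimately show "m' = m" by (intro arc_param_slope_unique[OF assms(1,2), of y m' x m]) simp
qed

lemma sum_flags_at:
  fixes F :: "flag \<Rightarrow> 'a::comm_monoid_add"
  assumes "finite (arcs G)"
  shows "sum F (flags_at G i) = (\<Sum>k | k \<in> arcs G \<and> tail G k = i. F (k, False))
     + (\<Sum>k | k \<in> arcs G \<and> head G k = i. F (k, True))"
proof -
  have eq: "flags_at G i = (\<lambda>k. (k, False)) ` {k \<in> arcs G. tail G k = i}
      \<union> (\<lambda>k. (k, True)) ` {k \<in> arcs G. head G k = i}"
    by (auto simp: flags_at_def)
  show ?thesis unfolding eq using assms
    by (subst sum.union_disjoint) (auto simp: sum.reindex inj_on_def)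
qed

lemma finite_flags_at: "finite (arcs G) \<Longrightarrow> finite (flags_at G i)"
  by (simp add: flags_at_def)

lemma sum_eq_pos_minus_neg:
  fixes F :: "'a \<Rightarrow> int"
  assumes "finite A"
  shows "sum F A = (\<Sum>x | x \<in> A \<and> F x > 0. \<bar>F x\<bar>) - (\<Sum>x | x \<in> A \<and> F x < 0. \<bar>F x\<bar>)"
proof -
  have "(\<Sum>x | x \<in> A \<and> F x > 0. \<bar>F x\<bar>) = (\<Sum>x\<in>A. if F x > 0 then \<bar>F x\<bar> else 0)"
    "(\<Sum>x | x \<in> A \<and> F x < 0. \<bar>F x\<bar>) = (\<Sum>x\<in>A. if F x < 0 then \<bar>F x\<bar> else 0)"
    using assms by (simp_all flip: sum.inter_filter)
  then show ?thesis by (auto simp flip: sum_subtractf intro!: sum.cong)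
qed

text \<open>The head flag of an edge carries the slope \<open>- s k\<close>, and outgoing minus
  incoming expansion factors is the sum of the signed slopes of all flags at the vertex.\<close>

lemma flag_balance_iff:
  assumes "L > 0" "finite (arcs G)"
    and "\<And>k. k \<in> arcs G \<Longrightarrow> edge_length C k > 0 \<and> has_slope L G C (k, False) (s k)"
  shows "(\<forall>i\<in>verts G.
        (\<Sum>f | f \<in> flags_at G i \<and> slope L G C f < 0. int (flag_expansion L G C f)) =
        (\<Sum>f | f \<in> flags_at G i \<and> slope L G C f > 0. int (flag_expansion L G C f)) - l i)
    \<longleftrightarrow> balanced G l s"
proof -
  have sl: "slope L G C (k, False) = s k" "slope L G C (k, True) = - s k" if "k \<in> arcs G" for k
    using assms(3)[OF that] has_slope_reverse by (auto intro!: slope_eqI assms(1))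
  have D: "(\<Sum>f | f \<in> flags_at G i \<and> slope L G C f > 0. int (flag_expansion L G C f))
      - (\<Sum>f | f \<in> flags_at G i \<and> slope L G C f < 0. int (flag_expansion L G C f))
    = (\<Sum>k | k \<in> arcs G \<and> tail G k = i. s k) - (\<Sum>k | k \<in> arcs G \<and> head G k = i. s k)" for i
  proof -
    have "(\<Sum>f | f \<in> flags_at G i \<and> slope L G C f > 0. int (flag_expansion L G C f))
      - (\<Sum>f | f \<in> flags_at G i \<and> slope L G C f < 0. int (flag_expansion L G C f))
      = sum (slope L G C) (flags_at G i)"
      using sum_eq_pos_minus_neg[OF finite_flags_at[OF assms(2)]] by (simp add: flag_expansion_def)
    also have "\<dots> = (\<Sum>k | k \<in> arcs G \<and> tail G k = i. s k) + (\<Sum>k | k \<in> arcs G \<and> head G k = i. - s k)"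
      by (simp add: sum_flags_at[OF assms(2)] sl)
    finally show ?thesis by (simp add: sum_negf)
  qed
  show ?thesis unfolding balanced_def
  proof (intro ball_cong refl)
    fix i
    show "(\<Sum>f | f \<in> flags_at G i \<and> slope L G C f < 0. int (flag_expansion L G C f)) =
        (\<Sum>f | f \<in> flags_at G i \<and> slope L G C f > 0. int (flag_expansion L G C f)) - l i
      \<longleftrightarrow> (\<Sum>k | k \<in> arcs G \<and> tail G k = i. s k) - (\<Sum>k | k \<in> arcs G \<and> head G k = i. s k) = l i"
      using D[of i] by linarith
  qed
qed

text \<open>One lift \<open>X\<close> of the marked points is fixed, so that the images of the
  vertices become real numbers in a single interval of length \<open>L\<close> starting at the lift
  of p_0.\<close>

locale circle_cover_setting =
  fixes G :: "(nat, nat) pre_digraph" and n :: nat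
    and \<Omega> :: "nat \<Rightarrow> nat" and a :: "nat \<Rightarrow> nat" and l :: "nat \<Rightarrow> int"
    and L :: real and p :: "nat \<Rightarrow> complex" and X :: "nat \<Rightarrow> real"
  assumes graph: "wf_digraph G" and finite_arcs [simp]: "finite (arcs G)"
    and verts_eq: "verts G = {1..n}"
    and perm: "\<Omega> permutes {1..n}"
    and loops_pos: "\<And>k. k \<in> loop_edges G \<Longrightarrow> a k > 0"
    and L: "L > 0"
    and X_step: "\<And>j. j < n \<Longrightarrow> X j < X (Suc j)" and X_last: "X n < X 0 + L"
    and p_eq: "\<And>j. j \<le> n \<Longrightarrow> p j = arc_param L (X j)"
begin

text \<open>The image of \<open>x\<^sub>i\<close>, lifted to the fundamental interval that starts at the base point.\<close>

definition pos :: "nat \<Rightarrow> real" where "pos i = X (\<Omega> i)"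

text \<open>The length of an edge that is mapped with slope \<open>m\<close> and passes the base point
  \<open>a k / \<bar>m\<bar>\<close> times.\<close>

definition covering_length :: "nat \<Rightarrow> int \<Rightarrow> real" where
  "covering_length k m =
     (pos (edge_target G k m) - pos (edge_source G k m) + L * (a k / \<bar>m\<bar>)) / \<bar>m\<bar>"

definition standard_cover :: "(nat \<Rightarrow> int) \<Rightarrow> graph_map" where
  "standard_cover s =
     \<lparr>edge_length = (\<lambda>k. covering_length k (s k)),
      cover_map = (\<lambda>x. case x of Vertex i \<Rightarrow> p (\<Omega> i)
        | Inner k t \<Rightarrow> arc_param L (pos (tail G k) + s k * t))\<rparr>"

lemma finite_verts [simp]: "finite (verts G)" by (simp add: verts_eq)

lemma X_less: "i < j \<Longrightarrow> j \<le> n \<Longrightarrow> X i < X j"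
proof (induction j)
  case (Suc j)
  then show ?case using X_step[of j] by (cases "i = j") auto
qed simp

lemma X_less_iff: "i \<le> n \<Longrightarrow> j \<le> n \<Longrightarrow> X i < X j \<longleftrightarrow> i < j"
  by (metis X_less linorder_neqE_nat order_less_asym order_less_irrefl)

lemma X_le_iff: "i \<le> n \<Longrightarrow> j \<le> n \<Longrightarrow> X i \<le> X j \<longleftrightarrow> i \<le> j"
  using X_less_iff by (meson not_less)

lemma tail_vert: "k \<in> arcs G \<Longrightarrow> tail G k \<in> verts G"
  using graph by (rule wf_digraph.tail_in_verts)

lemma head_vert: "k \<in> arcs G \<Longrightarrow> head G k \<in> verts G"
  using graph by (rule wf_digraph.head_in_verts)

lemma source_vert: "k \<in> arcs G \<Longrightarrow> edge_source G k m \<in> verts G"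
  and target_vert: "k \<in> arcs G \<Longrightarrow> edge_target G k m \<in> verts G"
  by (auto simp: edge_source_def edge_target_def tail_vert head_vert)

lemma order_bounds: "i \<in> verts G \<Longrightarrow> 1 \<le> \<Omega> i \<and> \<Omega> i \<le> n"
  using permutes_in_image[OF perm, of i] by (auto simp: verts_eq)

lemma order_inj: "\<Omega> i = \<Omega> j \<longleftrightarrow> i = j"
  using permutes_inj[OF perm] by (auto dest: injD)

lemma pos_bounds: "i \<in> verts G \<Longrightarrow> X 0 < pos i \<and> pos i < X 0 + L"
  using order_bounds[of i] X_less[of 0 "\<Omega> i"] X_last X_le_iff[of "\<Omega> i" n]
  by (auto simp: pos_def)

lemma pos_less_iff: "i \<in> verts G \<Longrightarrow> j \<in> verts G \<Longrightarrow> pos i < pos j \<longleftrightarrow> \<Omega> i < \<Omega> j"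
  by (simp add: pos_def X_less_iff order_bounds)

lemma p_vert: "i \<in> verts G \<Longrightarrow> p (\<Omega> i) = arc_param L (pos i)"
  by (simp add: pos_def p_eq order_bounds)

lemma p_0: "p 0 = arc_param L (X 0)" by (simp add: p_eq)

lemma vertex_not_over_base: "i \<in> verts G \<Longrightarrow> p (\<Omega> i) \<noteq> p 0"
proof
  assume i: "i \<in> verts G" and eq: "p (\<Omega> i) = p 0"
  then obtain N :: int where N: "pos i = X 0 + L * N"
    by (auto simp: p_vert p_0 arc_param_eq_iff[OF L])
  then have "L * 0 < L * N" "L * N < L * 1" using pos_bounds[OF i] by auto
  then have "0 < real_of_int N" "real_of_int N < 1" using L by (simp_all only: mult_less_cancel_left_pos)
  then show False by simp
qed

lemma signed_length:
  "m \<noteq> 0 \<Longrightarrow> of_int (sgn m) * (pos (head G k) - pos (tail G k))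
     = pos (edge_target G k m) - pos (edge_source G k m)"
  by (auto simp: edge_target_def edge_source_def sgn_if)

text \<open>The starting value in \<open>has_slope\<close> is determined only up to multiples of
  \<open>L\<close>; evaluation at the tail allows it to be normalized to
  \<open>pos (tail G k)\<close>.\<close>

lemma edge_parametrization:
  assumes "k \<in> arcs G" "edge_length C k > 0" "has_slope L G C (k, False) m"
    and "\<forall>i\<in>verts G. cover_map C (Vertex i) = p (\<Omega> i)" and t: "t \<in> {0..edge_length C k}"
  shows "cover_map C (edge_point G (edge_length C) k t) = arc_param L (pos (tail G k) + of_int m * t)"
proof -
  from assms(3) obtain x where
    x: "\<And>t. t \<in> {0..edge_length C k} \<Longrightarrow>
      cover_map C (edge_point G (edge_length C) k t) = arc_param L (x + of_int m * t)"
    by (auto simp: has_slope_def)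
  have "arc_param L x = arc_param L (pos (tail G k))"
    using x[of 0] assms by (auto simp: edge_point_def p_vert tail_vert)
  then obtain N :: int where "x = pos (tail G k) + L * N" by (auto simp: arc_param_eq_iff[OF L])
  then have "x + of_int m * t = (pos (tail G k) + of_int m * t) + L * N" by simp
  then show ?thesis using x[OF t] arc_param_shift[OF L] by metis
qed

text \<open>The degree condition counts points of the graph, \<open>card_crossings\<close> counts
  parameters of the path; over p_0 the two agree.\<close>

lemma base_preimages:
  assumes k: "k \<in> arcs G" and len: "edge_length C k > 0" and sl: "has_slope L G C (k, False) m"
    and V: "\<forall>i\<in>verts G. cover_map C (Vertex i) = p (\<Omega> i)" and m: "m \<noteq> 0"
  shows "of_int \<bar>m\<bar> * edge_length C k = pos (edge_target G k m) - pos (edge_source G k m)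
    + L * card {x \<in> edge_point G (edge_length C) k ` {0..edge_length C k}. cover_map C x = p 0}"
proof -
  let ?len = "edge_length C k"
  let ?A = "{t \<in> {0..?len}. arc_param L (pos (tail G k) + of_int m * t) = arc_param L (X 0)}"
  let ?e = "edge_point G (edge_length C) k"
  have par: "cover_map C (?e t) = arc_param L (pos (tail G k) + of_int m * t)" if "t \<in> {0..?len}" for t
    using edge_parametrization[OF k len sl V that] .
  have hd: "arc_param L (pos (tail G k) + of_int m * ?len) = arc_param L (pos (head G k))"
    using par[of ?len] len V k by (simp add: edge_point_def p_vert head_vert)
  have "{x \<in> ?e ` {0..?len}. cover_map C x = p 0} = ?e ` ?A"
    by (auto simp: par p_0)
  moreover have "inj_on ?e ?A"
  proof (rule inj_onI)
    fix t u assume tu: "t \<in> ?A" "u \<in> ?A" "?e t = ?e u"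
    \<comment> \<open>A crossing at an end of the edge would put a vertex over p_0. Away from the
      ends \<open>edge_point\<close> is injective, although it identifies both ends of a
      loop.\<close>
    have *: "v \<noteq> 0 \<and> v \<noteq> ?len" if "v \<in> ?A" for v
      using that vertex_not_over_base[OF tail_vert[OF k]] vertex_not_over_base[OF head_vert[OF k]] hd k
      by (auto simp: p_vert p_0 tail_vert head_vert)
    show "t = u" using tu(3) *[OF tu(1)] *[OF tu(2)] by (simp add: edge_point_def)
  qed
  ultimately have "card {x \<in> ?e ` {0..?len}. cover_map C x = p 0} = card ?A" by (simp add: card_image)
  moreover have "of_int \<bar>m\<bar> * ?len
      = of_int (sgn m) * (pos (head G k) - pos (tail G k)) + L * card ?A"
    using card_crossings[OF L m len _ _ _ _ hd, of "X 0"]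
      pos_bounds[OF tail_vert[OF k]] pos_bounds[OF head_vert[OF k]] by simp
  ultimately show ?thesis using signed_length[OF m] by simp
qed

text \<open>If \<open>a k > 0\<close> then \<open>\<bar>m\<bar> \<le> a k\<close>, so at least one
  full \<open>L\<close> is added, and this outweighs the difference of two positions inside an open
  interval of length \<open>L\<close>. If \<open>a k = 0\<close>, the order condition makes the
  difference itself positive.\<close>

lemma covering_length_pos:
  assumes k: "k \<in> arcs G" and m: "m \<in> valid_slopes G \<Omega> a k"
  shows "covering_length k m > 0"
proof -
  let ?u = "edge_source G k m" and ?v = "edge_target G k m"
  have uv: "?u \<in> verts G" "?v \<in> verts G" using k source_vert target_vert by auto
  have m0: "m \<noteq> 0" "m dvd int (a k)" using m by (auto simp: valid_slopes_def)
  have "pos ?v - pos ?u + L * (a k / \<bar>m\<bar>) > 0"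
  proof (cases "a k = 0")
    case True
    then show ?thesis using m uv by (simp add: valid_slopes_def pos_less_iff)
  next
    case False
    then have "\<bar>m\<bar> \<le> int (a k)" using m0 by (simp add: zdvd_imp_le)
    then have "1 \<le> a k / \<bar>m\<bar>" using m0 by (simp add: field_simps)
    then have "L * 1 \<le> L * (a k / \<bar>m\<bar>)" using L by (intro mult_left_mono) auto
    then show ?thesis using pos_bounds[OF uv(1)] pos_bounds[OF uv(2)] by linarith
  qed
  then show ?thesis using m0 by (simp add: covering_length_def)
qed

text \<open>Length and number of crossings determine each other by \<open>base_preimages\<close>, as
  \<open>L > 0\<close>. The cardinality condition is thereby traded for an explicit length, and
  positivity of that length forces the order condition when \<open>a k = 0\<close>.\<close>

lemma degree_condition_iff:
  assumes k: "k \<in> arcs G" and len: "edge_length C k > 0" and sl: "has_slope L G C (k, False) m"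
    and V: "\<forall>i\<in>verts G. cover_map C (Vertex i) = p (\<Omega> i)" and m: "m \<noteq> 0"
  shows "card {x \<in> edge_point G (edge_length C) k ` {0..edge_length C k}. cover_map C x = p 0}
      * expansion L G C k = a k
    \<longleftrightarrow> m \<in> valid_slopes G \<Omega> a k \<and> edge_length C k = covering_length k m"
proof -
  define c where "c = card {x \<in> edge_point G (edge_length C) k ` {0..edge_length C k}. cover_map C x = p 0}"
  have ex: "expansion L G C k = nat \<bar>m\<bar>"
    using slope_eqI[OF L _ sl] len by (simp add: expansion_def flag_expansion_def)
  have len_eq: "edge_length C k = (pos (edge_target G k m) - pos (edge_source G k m) + L * c) / \<bar>m\<bar>"
    using base_preimages[OF k len sl V m, folded c_def] m by (simp add: field_simps)
  have "c * expansion L G C k = a k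
    \<longleftrightarrow> m \<in> valid_slopes G \<Omega> a k \<and> edge_length C k = covering_length k m" (is "_ \<longleftrightarrow> ?R")
  proof
    assume "c * expansion L G C k = a k"
    then have ak: "a k = c * nat \<bar>m\<bar>" using ex by simp
    then have "int (a k) = int c * \<bar>m\<bar>" by simp
    then have dv: "m dvd int (a k)" by simp
    have "real (a k) = real c * real_of_int \<bar>m\<bar>" by (subst ak) simp
    then have "a k / \<bar>m\<bar> = c" using m by (simp add: field_simps)
    then have le: "edge_length C k = covering_length k m" unfolding covering_length_def using len_eq by simp
    have "\<Omega> (edge_source G k m) < \<Omega> (edge_target G k m)" if "a k = 0"
    proof -
      have "pos (edge_source G k m) < pos (edge_target G k m)"
        using len le that m by (simp add: covering_length_def zero_less_divide_iff)
      then show ?thesis using k by (simp add: pos_less_iff source_vert target_vert)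
    qed
    then show ?R using dv le m by (simp add: valid_slopes_def)
  next
    assume R: ?R
    then have "L * c / \<bar>m\<bar> = L * (a k / \<bar>m\<bar>) / \<bar>m\<bar>"
      using len_eq m by (simp add: covering_length_def add_divide_distrib)
    then have "L * c = L * (a k / \<bar>m\<bar>)" using m by (simp only: divide_cancel_right) simp
    then have "real c = a k / \<bar>m\<bar>" using L by (simp only: mult_cancel_left) simp
    then have "real c * real_of_int \<bar>m\<bar> = a k" using m by (simp add: field_simps)
    then have "real (c * nat \<bar>m\<bar>) = real (a k)" by simp
    then show "c * expansion L G C k = a k" unfolding ex by (simp only: of_nat_eq_iff)
  qed
  then show ?thesis unfolding c_def .
qed

section \<open>Leaky maps and admissible slopes\<close>

definition admissible :: "(nat \<Rightarrow> int) \<Rightarrow> bool" where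
  "admissible s \<longleftrightarrow> (\<forall>k\<in>arcs G. s k \<in> valid_slopes G \<Omega> a k) \<and> balanced G l s"

definition slopes :: "graph_map \<Rightarrow> nat \<Rightarrow> int" where
  "slopes C k = slope L G C (k, False)"

lemma expansion_eq: "expansion L G C k = nat \<bar>slopes C k\<bar>"
  by (simp add: expansion_def flag_expansion_def slopes_def)

lemma leaky_maps_edge:
  assumes "C \<in> leaky_maps L p G \<Omega> a l" and k: "k \<in> arcs G"
  shows "edge_length C k > 0" and "has_slope L G C (k, False) (slopes C k)" and "slopes C k \<noteq> 0"
proof -
  show len: "edge_length C k > 0" using assms by (simp add: leaky_maps_def)
  obtain m where m: "m \<noteq> 0" "has_slope L G C (k, False) m"
    using assms by (auto simp: leaky_maps_def)
  have "slopes C k = m" unfolding slopes_def using slope_eqI[OF L _ m(2)] len by simp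
  then show "has_slope L G C (k, False) (slopes C k)" "slopes C k \<noteq> 0" using m by simp_all
qed

lemma leaky_maps_vertex:
  "C \<in> leaky_maps L p G \<Omega> a l \<Longrightarrow> \<forall>i\<in>verts G. cover_map C (Vertex i) = p (\<Omega> i)"
  by (simp add: leaky_maps_def)

lemma leaky_maps_parametrization:
  assumes "C \<in> leaky_maps L p G \<Omega> a l" and "k \<in> arcs G" and "t \<in> {0..edge_length C k}"
  shows "cover_map C (edge_point G (edge_length C) k t)
    = arc_param L (pos (tail G k) + of_int (slopes C k) * t)"
  using edge_parametrization[OF assms(2) leaky_maps_edge(1,2)[OF assms(1,2)]
      leaky_maps_vertex[OF assms(1)] assms(3)] .

lemma leaky_maps_length:
  assumes C: "C \<in> leaky_maps L p G \<Omega> a l" and k: "k \<in> arcs G"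
  shows "slopes C k \<in> valid_slopes G \<Omega> a k"
    and "edge_length C k = covering_length k (slopes C k)"
proof -
  have "card {x \<in> edge_point G (edge_length C) k ` {0..edge_length C k}. cover_map C x = p 0}
      * expansion L G C k = a k"
    using C k by (simp add: leaky_maps_def)
  then show "slopes C k \<in> valid_slopes G \<Omega> a k"
    and "edge_length C k = covering_length k (slopes C k)"
    by (simp_all add: degree_condition_iff[OF k leaky_maps_edge(1,2)[OF C k] leaky_maps_vertex[OF C]
        leaky_maps_edge(3)[OF C k]])
qed

lemma leaky_maps_admissible:
  assumes C: "C \<in> leaky_maps L p G \<Omega> a l"
  shows "admissible (slopes C)"
proof -
  have "balanced G l (slopes C)"
    using flag_balance_iff[of L G C "slopes C" l] leaky_maps_edge[OF C] L C
    by (simp add: leaky_maps_def)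
  then show ?thesis using leaky_maps_length[OF C] by (simp add: admissible_def)
qed

text \<open>Along the interior the slope is built in. The point to check is the head, where the path
  must arrive at \<open>pos (head G k)\<close> up to a multiple of \<open>L\<close>; divisibility of
  \<open>a k\<close> by the slope guarantees this.\<close>

lemma standard_cover_slope:
  assumes k: "k \<in> arcs G" and valid: "s k \<in> valid_slopes G \<Omega> a k"
  shows "has_slope L G (standard_cover s) (k, False) (s k)"
  unfolding has_slope_def
proof (intro exI ballI)
  let ?len = "covering_length k (s k)" and ?C = "standard_cover s"
  fix t assume "t \<in> {0..edge_length ?C (fst (k, False))}"
  then have t: "0 \<le> t" "t \<le> ?len" by (simp_all add: standard_cover_def)
  have s0: "s k \<noteq> 0" and dv: "s k dvd int (a k)" using valid by (auto simp: valid_slopes_def)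
  have len: "?len > 0" using covering_length_pos[OF k valid] .
  show "cover_map ?C (flag_point G (edge_length ?C) (k, False) t)
      = arc_param L (pos (tail G k) + of_int (s k) * t)"
  proof (cases "t = ?len")
    case True
    \<comment> \<open>For \<open>a k > 0\<close> the quotient \<open>d\<close> has the sign of
      \<open>s k\<close>: it is a signed crossing number, so one formula serves both
      directions.\<close>
    obtain d where d: "int (a k) = s k * d" using dv by (rule dvdE)
    have "real (a k) = of_int (int (a k))" by simp
    also have "\<dots> = of_int (s k) * of_int d" unfolding d by simp
    finally have ad: "real (a k) = of_int (s k) * of_int d" .
    have "of_int (s k) * ?len = of_int (sgn (s k))
        * (of_int (sgn (s k)) * (pos (head G k) - pos (tail G k)) + L * (a k / \<bar>s k\<bar>))"
      unfolding covering_length_def signed_length[OF s0]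
      using s0 by (simp add: field_simps sgn_if)
    also have "\<dots> = pos (head G k) - pos (tail G k) + L * of_int d"
      using s0 by (simp add: ad sgn_if field_simps)
    finally have "pos (tail G k) + of_int (s k) * ?len = pos (head G k) + L * of_int d" by simp
    then have "arc_param L (pos (tail G k) + of_int (s k) * t) = arc_param L (pos (head G k))"
      using arc_param_shift[OF L] True by simp
    then show ?thesis using True len k
      by (simp add: standard_cover_def edge_point_def p_vert head_vert)
  next
    case False
    then show ?thesis using t len k
      by (simp add: standard_cover_def edge_point_def p_vert tail_vert)
  qed
qed

text \<open>Every admissible slope function is realized: the lengths are those demanded by
  \<open>degree_condition_iff\<close>, and balancing depends on the slopes alone.\<close>

lemma standard_cover:
  assumes s: "admissible s"
  shows "standard_cover s \<in> leaky_maps L p G \<Omega> a l"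
    and "k \<in> arcs G \<Longrightarrow> slopes (standard_cover s) k = s k"
proof -
  let ?C = "standard_cover s"
  have valid: "s k \<in> valid_slopes G \<Omega> a k" if "k \<in> arcs G" for k using s that by (simp add: admissible_def)
  have s0: "s k \<noteq> 0" if "k \<in> arcs G" for k using valid[OF that] by (simp add: valid_slopes_def)
  have len: "edge_length ?C k > 0" if "k \<in> arcs G" for k
    using covering_length_pos[OF that valid[OF that]] by (simp add: standard_cover_def)
  have sl: "has_slope L G ?C (k, False) (s k)" if "k \<in> arcs G" for k
    using standard_cover_slope[of k s, OF that valid[OF that]] .
  have V: "\<forall>i\<in>verts G. cover_map ?C (Vertex i) = p (\<Omega> i)" by (simp add: standard_cover_def)
  have img: "cover_map ?C ` points G (edge_length ?C) \<subseteq> circle L"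
    using L by (auto simp: points_def standard_cover_def p_vert arc_param_in_circle)
  have deg: "card {x \<in> edge_point G (edge_length ?C) k ` {0..edge_length ?C k}. cover_map ?C x = p 0}
      * expansion L G ?C k = a k" if k: "k \<in> arcs G" for k
    using degree_condition_iff[OF k len[OF k] sl[OF k] V s0[OF k]] valid[OF k]
    by (simp add: standard_cover_def)
  have bal: "balanced G l s" using s by (simp add: admissible_def)
  have "(\<forall>i\<in>verts G.
        (\<Sum>f | f \<in> flags_at G i \<and> slope L G ?C f < 0. int (flag_expansion L G ?C f)) =
        (\<Sum>f | f \<in> flags_at G i \<and> slope L G ?C f > 0. int (flag_expansion L G ?C f)) - l i)"
    by (subst flag_balance_iff[OF L finite_arcs, of ?C s]) (simp_all add: len sl bal)
  then show "?C \<in> leaky_maps L p G \<Omega> a l"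
    unfolding leaky_maps_def using len sl V img deg s0 by blast
  show "slopes ?C k = s k" if "k \<in> arcs G"
    unfolding slopes_def using slope_eqI[OF L _ sl[OF that]] len[OF that] by simp
qed

section \<open>Isomorphism in terms of slopes\<close>

definition same_up_to_loops :: "(nat \<Rightarrow> int) \<Rightarrow> (nat \<Rightarrow> int) \<Rightarrow> bool" where
  "same_up_to_loops s s' \<longleftrightarrow> (\<forall>k\<in>arcs G. s' k = s k \<or> k \<in> loop_edges G \<and> s' k = - s k)"

text \<open>Compatibility with the maps to the circle lets the lifts on the two copies of an edge be
  compared, directly or after reversal. Reversal sends the tail to the head although vertices are
  fixed, so it can occur only on loops.\<close>

lemma isomorphic_imp_same_slopes:
  assumes C: "C \<in> leaky_maps L p G \<Omega> a l" and D: "D \<in> leaky_maps L p G \<Omega> a l"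
    and iso: "isomorphic G C D"
  shows "same_up_to_loops (slopes C) (slopes D)"
  unfolding same_up_to_loops_def
proof
  fix k assume k: "k \<in> arcs G"
  let ?len = "edge_length C k"
  note len = leaky_maps_edge(1)[OF C k]
  obtain \<phi> where V: "\<And>i. i \<in> verts G \<Longrightarrow> \<phi> (Vertex i) = Vertex i"
    and eq: "edge_length D k = ?len"
    and alt: "(\<forall>t\<in>{0..?len}. \<phi> (edge_point G (edge_length C) k t) = edge_point G (edge_length D) k t) \<or>
       (\<forall>t\<in>{0..?len}. \<phi> (edge_point G (edge_length C) k t) = edge_point G (edge_length D) k (?len - t))"
    and com: "\<And>x. x \<in> points G (edge_length C) \<Longrightarrow> cover_map D (\<phi> x) = cover_map C x"
    using iso k unfolding isomorphic_def by (metis (no_types, lifting))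
  have pt: "edge_point G (edge_length C) k t \<in> points G (edge_length C)" if "t \<in> {0..?len}" for t
    using that k by (auto simp: edge_point_def points_def tail_vert head_vert)
  from alt show "slopes D k = slopes C k \<or> k \<in> loop_edges G \<and> slopes D k = - slopes C k"
  proof
    assume id: "\<forall>t\<in>{0..?len}. \<phi> (edge_point G (edge_length C) k t) = edge_point G (edge_length D) k t"
    have "slopes D k = slopes C k"
    proof (rule arc_param_slope_unique[OF L len])
      fix t assume t: "t \<in> {0..?len}"
      then have "cover_map D (edge_point G (edge_length D) k t) = cover_map C (edge_point G (edge_length C) k t)"
        using com[OF pt[OF t]] id by simp
      then show "arc_param L (pos (tail G k) + of_int (slopes D k) * t)
          = arc_param L (pos (tail G k) + of_int (slopes C k) * t)"
        using leaky_maps_parametrization[OF C k t] leaky_maps_parametrization[OF D k, of t] t eq by simp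
    qed
    then show ?thesis ..
  next
    assume rev: "\<forall>t\<in>{0..?len}. \<phi> (edge_point G (edge_length C) k t) = edge_point G (edge_length D) k (?len - t)"
    from bspec[OF rev, of 0] have "tail G k = head G k"
      using len eq V[OF tail_vert[OF k]] by (simp add: edge_point_def)
    then have "k \<in> loop_edges G" using k by (simp add: loop_edges_def)
    moreover have "- slopes D k = slopes C k"
    proof (rule arc_param_slope_unique[OF L len])
      fix t assume t: "t \<in> {0..?len}"
      then have t': "?len - t \<in> {0..edge_length D k}" using eq by simp
      have "cover_map D (edge_point G (edge_length D) k (?len - t)) = cover_map C (edge_point G (edge_length C) k t)"
        using com[OF pt[OF t]] rev t by simp
      then show "arc_param L (pos (tail G k) + of_int (slopes D k) * ?len + of_int (- slopes D k) * t)
          = arc_param L (pos (tail G k) + of_int (slopes C k) * t)"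
        using leaky_maps_parametrization[OF C k t] leaky_maps_parametrization[OF D k t']
        by (simp add: algebra_simps)
    qed
    ultimately show ?thesis by simp
  qed
qed

lemma covering_length_loop:
  "k \<in> loop_edges G \<Longrightarrow> covering_length k (- m) = covering_length k m"
  by (simp add: covering_length_def loop_edges_def edge_source_def edge_target_def)

text \<open>The isomorphism reverses exactly those loops on which the slopes differ. Lengths agree
  because the covering length of a loop does not depend on the sign of the slope, and so
  \<open>\<phi>\<close> is an involution of a common point set.\<close>

lemma same_slopes_imp_isomorphic:
  assumes C: "C \<in> leaky_maps L p G \<Omega> a l" and D: "D \<in> leaky_maps L p G \<Omega> a l"
    and same: "same_up_to_loops (slopes C) (slopes D)"
  shows "isomorphic G C D"
proof -
  let ?len = "edge_length C"
  define \<phi> where "\<phi> x = (case x of Vertex i \<Rightarrow> Vertex i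
     | Inner k t \<Rightarrow> if slopes D k = slopes C k then Inner k t else Inner k (?len k - t))" for x
  have alt: "slopes D k = slopes C k \<or> k \<in> loop_edges G \<and> slopes D k = - slopes C k" if "k \<in> arcs G" for k
    using same that by (auto simp: same_up_to_loops_def)
  have eq: "edge_length D k = ?len k" if k: "k \<in> arcs G" for k
    using leaky_maps_length(2)[OF C k] leaky_maps_length(2)[OF D k] alt[OF k]
    by (auto simp: covering_length_loop)
  have points_eq: "points G (edge_length D) = points G ?len"
    by (auto simp: points_def eq)
  have \<phi>_edge: "if slopes D k = slopes C k
      then \<forall>t\<in>{0..?len k}. \<phi> (edge_point G ?len k t) = edge_point G (edge_length D) k t
      else \<forall>t\<in>{0..?len k}. \<phi> (edge_point G ?len k t) = edge_point G (edge_length D) k (?len k - t)"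
    if k: "k \<in> arcs G" for k
  proof (cases "slopes D k = slopes C k")
    case True
    then show ?thesis using eq[OF k] by (auto simp: \<phi>_def edge_point_def)
  next
    case False
    then have "tail G k = head G k" using alt[OF k] by (auto simp: loop_edges_def)
    then show ?thesis using eq[OF k] False leaky_maps_edge(1)[OF C k] by (auto simp: \<phi>_def edge_point_def)
  qed
  have inv: "\<phi> (\<phi> x) = x" for x by (cases x) (auto simp: \<phi>_def)
  have into: "\<phi> x \<in> points G ?len" if "x \<in> points G ?len" for x
    using that by (fastforce simp: points_def \<phi>_def)
  have bij: "bij_betw \<phi> (points G ?len) (points G (edge_length D))"
    unfolding points_eq by (rule bij_betwI[where g = \<phi>]) (auto simp: inv into)
  have com: "cover_map D (\<phi> x) = cover_map C x" if x: "x \<in> points G ?len" for x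
  proof -
    consider i where "i \<in> verts G" "x = Vertex i"
      | k t where "k \<in> arcs G" "0 < t" "t < ?len k" "x = Inner k t"
      using x by (auto simp: points_def)
    then show ?thesis
    proof cases
      case 1
      then show ?thesis using leaky_maps_vertex[OF C] leaky_maps_vertex[OF D] by (simp add: \<phi>_def)
    next
      case (2 k t)
      have xe: "x = edge_point G ?len k t" using 2 by (simp add: edge_point_def)
      have t: "t \<in> {0..?len k}" "t \<in> {0..edge_length D k}" "?len k - t \<in> {0..edge_length D k}"
        using 2 eq by auto
      note Cx = leaky_maps_parametrization[OF C 2(1) t(1), folded xe]
      show ?thesis
      proof (cases "slopes D k = slopes C k")
        case True
        then have "\<phi> x = edge_point G (edge_length D) k t" using \<phi>_edge[OF 2(1)] t xe by simp
        then show ?thesis using Cx leaky_maps_parametrization[OF D 2(1) t(2)] True by simp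
      next
        case False
        then have lp: "k \<in> loop_edges G" and sD: "slopes D k = - slopes C k" using alt[OF 2(1)] by auto
        have "\<phi> x = edge_point G (edge_length D) k (?len k - t)" using \<phi>_edge[OF 2(1)] t xe False by simp
        then have Dx: "cover_map D (\<phi> x)
            = arc_param L (pos (tail G k) + of_int (slopes C k) * t - of_int (slopes C k) * ?len k)"
          using leaky_maps_parametrization[OF D 2(1) t(3)] sD by (simp add: algebra_simps)
        \<comment> \<open>The image of a loop is a closed path, so slope times length is a multiple
          of \<open>L\<close> and the reversed parametrization describes the same points of the
          circle.\<close>
        have "arc_param L (pos (tail G k) + of_int (slopes C k) * ?len k) = arc_param L (pos (tail G k))"
          using leaky_maps_parametrization[OF C 2(1), of "?len k"] leaky_maps_edge(1)[OF C 2(1)]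
            leaky_maps_vertex[OF C] lp 2(1)
          by (simp add: edge_point_def loop_edges_def p_vert head_vert)
        then obtain N :: int where N: "of_int (slopes C k) * ?len k = L * N"
          by (auto simp: arc_param_eq_iff[OF L])
        show ?thesis unfolding Dx Cx N
          using arc_param_shift[OF L, of "pos (tail G k) + of_int (slopes C k) * t" "- N"] by simp
      qed
    qed
  qed
  show ?thesis unfolding isomorphic_def
  proof (intro exI[of _ \<phi>] conjI ballI bij com)
    show "\<phi> (Vertex i) = Vertex i" for i by (simp add: \<phi>_def)
    show "edge_length C k = edge_length D k" if "k \<in> arcs G" for k using eq[OF that] by simp
    show "(\<forall>t\<in>{0..?len k}. \<phi> (edge_point G ?len k t) = edge_point G (edge_length D) k t) \<or>
      (\<forall>t\<in>{0..?len k}. \<phi> (edge_point G ?len k t)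
         = edge_point G (edge_length D) k (edge_length D k - t))" if k: "k \<in> arcs G" for k
      using \<phi>_edge[OF k] eq[OF k] by (simp split: if_splits)
  qed
qed

end

section \<open>Tuples\<close>

text \<open>The exponent vector of the fraction tail over head raised to the power \<open>m\<close>;
  for negative \<open>m\<close> this is head over tail to the power \<open>\<bar>m\<bar>\<close>,
  hence always source over target.\<close>

definition edge_monomial :: "(nat, nat) pre_digraph \<Rightarrow> nat \<Rightarrow> int \<Rightarrow> (nat \<Rightarrow>\<^sub>0 int)" where
  "edge_monomial G k m = Poly_Mapping.single (tail G k) m - Poly_Mapping.single (head G k) m"

lemma edge_monomial_loop: "k \<in> loop_edges G \<Longrightarrow> edge_monomial G k m = 0"
  by (simp add: edge_monomial_def loop_edges_def)

lemma edge_monomial_inj: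
  assumes "tail G k \<noteq> head G k" "edge_monomial G k m = edge_monomial G k m'"
  shows "m = m'"
  using arg_cong[OF assms(2), of "\<lambda>f. Poly_Mapping.lookup f (tail G k)"] assms(1)
  by (simp add: edge_monomial_def lookup_minus lookup_single)

lemma edge_monomial_source_target:
  "Poly_Mapping.single (edge_source G k m) (abs m) - Poly_Mapping.single (edge_target G k m) (abs m)
    = edge_monomial G k m"
  by (auto simp: edge_monomial_def edge_source_def edge_target_def abs_if single_uminus)

lemma x_fraction_power:
  "x_fraction u v ^ w
    = Poly_Mapping.single (Poly_Mapping.single u (int w) - Poly_Mapping.single v (int w)) 1"
proof (induction w)
  case (Suc w)
  have "x_fraction u v * Poly_Mapping.single (Poly_Mapping.single u (int w) - Poly_Mapping.single v (int w)) 1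
    = Poly_Mapping.single (Poly_Mapping.single u (1 + int w) - Poly_Mapping.single v (1 + int w)) 1"
    by (simp add: x_fraction_def mult_single single_add algebra_simps)
  then show ?case using Suc by simp
qed simp

lemma x_fraction_power_edge:
  "x_fraction (edge_source G k m) (edge_target G k m) ^ nat \<bar>m\<bar>
    = Poly_Mapping.single (edge_monomial G k m) 1"
  using edge_monomial_source_target[of G k m] by (simp add: x_fraction_power)

lemma prod_single_one:
  "(\<Prod>k\<in>K. Poly_Mapping.single (f k) (1::'a::comm_semiring_1))
    = Poly_Mapping.single (\<Sum>k\<in>K. f k) 1"
  by (induction K rule: infinite_finite_induct) (simp_all add: mult_single)

lemma of_int_mult_single:
  "of_int z * Poly_Mapping.single x 1 = Poly_Mapping.single x (of_int z)"
  by (simp add: mult_single flip: single_of_int)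

lemma single_eq_imp_key_eq:
  assumes "Poly_Mapping.single x v = Poly_Mapping.single y w" "v \<noteq> 0"
  shows "x = y"
  using arg_cong[OF assms(1), of Poly_Mapping.keys] assms(2) by (auto split: if_splits)

lemma lookup_exponents:
  "finite I \<Longrightarrow> Poly_Mapping.lookup (exponents I e) i = (if i \<in> I then e i else 0)"
  by (simp add: exponents_def lookup_sum lookup_single when_def)

text \<open>Isomorphisms may reverse a loop edge, so only the absolute value of its slope is an invariant.\<close>

definition canonical_slopes ::
  "(nat, nat) pre_digraph \<Rightarrow> (nat \<Rightarrow> nat) \<Rightarrow> (nat \<Rightarrow> nat) \<Rightarrow> nat \<Rightarrow> int set" where
  "canonical_slopes G \<Omega> a k = {m \<in> valid_slopes G \<Omega> a k. k \<in> loop_edges G \<longrightarrow> m > 0}"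

text \<open>The tuple of a cover depends only on its slopes, so the desired bijection can be
  factored through slope functions.\<close>

definition slope_tuple ::
  "(nat, nat) pre_digraph \<Rightarrow> (nat \<Rightarrow> nat) \<Rightarrow> (nat \<Rightarrow> int) \<Rightarrow> (nat \<Rightarrow> nat) \<times> (nat \<Rightarrow> nat \<times> laurent)" where
  "slope_tuple G a s = make_tuple G a (\<lambda>k. nat \<bar>s k\<bar>)
     (\<lambda>k. edge_source G k (s k)) (\<lambda>k. edge_target G k (s k))"

lemma slope_tuple_eq:
  "slope_tuple G a s = (\<lambda>k\<in>loop_edges G. nat \<bar>s k\<bar>,
    \<lambda>k\<in>nonloop_edges G. (a k, Poly_Mapping.single (edge_monomial G k (s k)) \<bar>s k\<bar>))"
  by (auto simp: slope_tuple_def make_tuple_def x_fraction_power_edge of_int_mult_single fun_eq_iff)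

lemma arcs_cases: "k \<in> arcs G \<longleftrightarrow> k \<in> loop_edges G \<or> k \<in> nonloop_edges G"
  by (auto simp: loop_edges_def nonloop_edges_def)

lemma make_tuple_cong:
  assumes "\<And>k. k \<in> arcs G \<Longrightarrow> w k = w' k"
    and "\<And>k. k \<in> nonloop_edges G \<Longrightarrow> u k = u' k" "\<And>k. k \<in> nonloop_edges G \<Longrightarrow> v k = v' k"
  shows "make_tuple G a w u v = make_tuple G a w' u' v'"
  using assms by (auto simp: make_tuple_def arcs_cases intro!: restrict_ext)

text \<open>Summation by parts on the graph. The weight \<open>c\<close> will be the order (to bound
  slopes), the indicator of an initial segment of the order (to compute degrees over arcs), and the
  constant 1 (the leaks add up to 0).\<close>

lemma balanced_sum:
  assumes "finite (arcs G)" "finite (verts G)" "wf_digraph G" "balanced G l s"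
  shows "(\<Sum>i\<in>verts G. c i * l i) = (\<Sum>k\<in>arcs G. s k * (c (tail G k) - c (head G k)))"
proof -
  have tl: "(\<Sum>i\<in>verts G. \<Sum>k | k \<in> arcs G \<and> tail G k = i. c i * s k) = (\<Sum>k\<in>arcs G. c (tail G k) * s k)"
    by (subst sum.group[of _ _ "tail G", symmetric, OF assms(1,2)])
      (auto simp: wf_digraph.tail_in_verts[OF assms(3)] intro!: sum.cong)
  have hd: "(\<Sum>i\<in>verts G. \<Sum>k | k \<in> arcs G \<and> head G k = i. c i * s k) = (\<Sum>k\<in>arcs G. c (head G k) * s k)"
    by (subst sum.group[of _ _ "head G", symmetric, OF assms(1,2)])
      (auto simp: wf_digraph.head_in_verts[OF assms(3)] intro!: sum.cong)
  have "(\<Sum>i\<in>verts G. c i * l i) = (\<Sum>i\<in>verts G. c i *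
      ((\<Sum>k | k \<in> arcs G \<and> tail G k = i. s k) - (\<Sum>k | k \<in> arcs G \<and> head G k = i. s k)))"
    using assms(4) by (intro sum.cong) (auto simp: balanced_def)
  also have "\<dots> = (\<Sum>k\<in>arcs G. s k * (c (tail G k) - c (head G k)))"
    using tl hd by (simp add: right_diff_distrib sum_subtractf sum_distrib_left mult.commute)
  finally show ?thesis .
qed

text \<open>The exponent of x_i in the product of the edge monomials is the net outflow at
  x_i.\<close>

lemma balanced_iff_monomial:
  assumes "finite (arcs G)" "finite (verts G)" "wf_digraph G"
  shows "balanced G l s \<longleftrightarrow> (\<Sum>k\<in>arcs G. edge_monomial G k (s k)) = exponents (verts G) l"
proof -
  have lk: "Poly_Mapping.lookup (\<Sum>k\<in>arcs G. edge_monomial G k (s k)) i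
      = (\<Sum>k | k \<in> arcs G \<and> tail G k = i. s k) - (\<Sum>k | k \<in> arcs G \<and> head G k = i. s k)" for i
    using assms(1)
    by (simp add: edge_monomial_def lookup_sum lookup_minus lookup_single when_def sum_subtractf
        sum.inter_filter)
  have out: "Poly_Mapping.lookup (\<Sum>k\<in>arcs G. edge_monomial G k (s k)) i = 0" if "i \<notin> verts G" for i
  proof -
    have "{k \<in> arcs G. tail G k = i} = {}" "{k \<in> arcs G. head G k = i} = {}"
      using that assms(3) by (auto simp: wf_digraph.tail_in_verts wf_digraph.head_in_verts)
    then show ?thesis by (simp only: lk)
  qed
  show ?thesis
    unfolding balanced_def poly_mapping_eq_iff fun_eq_iff lookup_exponents[OF assms(2)]
    using lk out by auto
qed

section \<open>Canonical slope functions and their tuples\<close>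

context circle_cover_setting
begin

text \<open>\<open>PiE\<close> fixes the values off the arcs and \<open>canonical_slopes\<close> the
  signs on loops, so that each isomorphism class will be represented exactly once.\<close>

definition canonical :: "(nat \<Rightarrow> int) set" where
  "canonical = {s \<in> PiE (arcs G) (canonical_slopes G \<Omega> a). balanced G l s}"

definition canonicalize :: "(nat \<Rightarrow> int) \<Rightarrow> nat \<Rightarrow> int" where
  "canonicalize s = (\<lambda>k\<in>arcs G. if k \<in> loop_edges G then \<bar>s k\<bar> else s k)"

lemmas balanced_iff = balanced_iff_monomial[OF finite_arcs finite_verts graph]

lemma balanced_cong:
  assumes "\<And>k. k \<in> nonloop_edges G \<Longrightarrow> s k = s' k"
  shows "balanced G l s \<longleftrightarrow> balanced G l s'"
proof -
  have "(\<Sum>k\<in>arcs G. edge_monomial G k (s k)) = (\<Sum>k\<in>arcs G. edge_monomial G k (s' k))"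
    using assms by (intro sum.cong refl) (metis arcs_cases edge_monomial_loop)
  then show ?thesis by (simp add: balanced_iff)
qed

lemma canonical_imp_admissible: "s \<in> canonical \<Longrightarrow> admissible s"
  by (auto simp: canonical_def admissible_def canonical_slopes_def PiE_iff)

text \<open>A sign change on a loop preserves balancing and divisibility, and the order condition is
  void there because \<open>a k > 0\<close>.\<close>

lemma canonicalize_admissible: "admissible s \<Longrightarrow> canonicalize s \<in> canonical"
proof -
  assume s: "admissible s"
  have "balanced G l (canonicalize s)"
    using s balanced_cong[of s "canonicalize s"]
    by (auto simp: admissible_def canonicalize_def nonloop_edges_def loop_edges_def)
  moreover have "canonicalize s k \<in> canonical_slopes G \<Omega> a k" if "k \<in> arcs G" for k
    using s that loops_pos[of k]
    by (fastforce simp: admissible_def canonicalize_def canonical_slopes_def valid_slopes_def)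
  ultimately show ?thesis by (auto simp: canonical_def canonicalize_def)
qed

lemma canonicalize_canonical: "s \<in> canonical \<Longrightarrow> canonicalize s = s"
  by (fastforce simp: canonical_def canonicalize_def canonical_slopes_def PiE_iff fun_eq_iff
      extensional_def)

lemma canonicalize_eq_iff: "canonicalize s = canonicalize s' \<longleftrightarrow> same_up_to_loops s s'"
  by (auto simp: canonicalize_def same_up_to_loops_def fun_eq_iff restrict_def abs_eq_iff)

lemma slope_tuple_canonicalize: "slope_tuple G a (canonicalize s) = slope_tuple G a s"
  by (auto simp: slope_tuple_eq canonicalize_def restrict_def fun_eq_iff nonloop_edges_def loop_edges_def)

lemma cover_tuple_eq: "cover_tuple L G a C = slope_tuple G a (slopes C)"
  by (simp add: cover_tuple_def slope_tuple_def edge_source_def edge_target_def expansion_eq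
      slopes_def fun_eq_iff make_tuple_def restrict_def)

text \<open>On a loop the absolute value suffices, as the slope is positive. On a non-loop edge the
  exponent vector of the Laurent monomial recovers the slope with its sign, since the two ends are
  different variables and the coefficient is nonzero.\<close>

lemma inj_on_slope_tuple: "inj_on (slope_tuple G a) canonical"
proof (rule inj_onI)
  fix s s' assume s: "s \<in> canonical" "s' \<in> canonical" and eq: "slope_tuple G a s = slope_tuple G a s'"
  show "s = s'"
  proof (rule PiE_ext[of s "arcs G" "canonical_slopes G \<Omega> a"])
    fix k assume k: "k \<in> arcs G"
    have sk: "s k \<in> canonical_slopes G \<Omega> a k" "s' k \<in> canonical_slopes G \<Omega> a k"
      using s k by (auto simp: canonical_def)
    show "s k = s' k"
    proof (cases "k \<in> loop_edges G")
      case True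
      have "nat \<bar>s k\<bar> = nat \<bar>s' k\<bar>"
        using fun_cong[OF arg_cong[OF eq, of fst], of k] True by (simp add: slope_tuple_eq)
      then show ?thesis using sk True by (auto simp: canonical_slopes_def)
    next
      case False
      then have nl: "k \<in> nonloop_edges G" using k arcs_cases by blast
      have "Poly_Mapping.single (edge_monomial G k (s k)) \<bar>s k\<bar>
          = Poly_Mapping.single (edge_monomial G k (s' k)) \<bar>s' k\<bar>"
        using fun_cong[OF arg_cong[OF eq, of snd], of k] nl by (simp add: slope_tuple_eq)
      then have "edge_monomial G k (s k) = edge_monomial G k (s' k)"
        by (rule single_eq_imp_key_eq) (use sk in \<open>auto simp: canonical_slopes_def valid_slopes_def\<close>)
      then show ?thesis using nl by (intro edge_monomial_inj) (auto simp: nonloop_edges_def)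
    qed
  qed (use s in \<open>auto simp: canonical_def\<close>)
qed

text \<open>Loops have trivial monomials, so the product over the non-loop edges already expresses
  the whole balancing condition.\<close>

lemma prod_fraction_iff:
  assumes "\<And>k. k \<in> nonloop_edges G \<Longrightarrow>
    x_fraction (u k) (v k) ^ w k = Poly_Mapping.single (edge_monomial G k (s k)) 1"
  shows "(\<Prod>k\<in>nonloop_edges G. x_fraction (u k) (v k) ^ w k) = x_monomial (verts G) l
    \<longleftrightarrow> balanced G l s"
proof -
  have "(\<Prod>k\<in>nonloop_edges G. x_fraction (u k) (v k) ^ w k)
      = Poly_Mapping.single (\<Sum>k\<in>nonloop_edges G. edge_monomial G k (s k)) 1"
    using assms by (simp add: prod_single_one)
  also have "(\<Sum>k\<in>nonloop_edges G. edge_monomial G k (s k)) = (\<Sum>k\<in>arcs G. edge_monomial G k (s k))"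
    by (intro sum.mono_neutral_left) (auto simp: nonloop_edges_def edge_monomial_loop loop_edges_def)
  finally show ?thesis by (auto simp: x_monomial_def balanced_iff dest: single_eq_imp_key_eq)
qed

lemma ends_source_target:
  assumes k: "k \<in> nonloop_edges G"
  shows "{edge_source G k m, edge_target G k m} = {lower_end G \<Omega> k, upper_end G \<Omega> k}"
    and "\<Omega> (edge_source G k m) < \<Omega> (edge_target G k m) \<longleftrightarrow>
      edge_source G k m = lower_end G \<Omega> k \<and> edge_target G k m = upper_end G \<Omega> k"
  using k order_inj[of "tail G k" "head G k"]
  by (auto simp: edge_source_def edge_target_def lower_end_def upper_end_def nonloop_edges_def)

lemma tuples_eq: "tuples G \<Omega> a l = slope_tuple G a ` canonical"
proof (intro subset_antisym subsetI)
  fix T assume "T \<in> slope_tuple G a ` canonical"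
  then obtain s where s: "s \<in> canonical" and T: "T = slope_tuple G a s" by auto
  have sk: "s k \<in> valid_slopes G \<Omega> a k" if "k \<in> arcs G" for k
    using canonical_imp_admissible[OF s] that by (simp add: admissible_def)
  have 1: "(\<forall>k\<in>arcs G. nat \<bar>s k\<bar> > 0 \<and> (a k \<noteq> 0 \<longrightarrow> nat \<bar>s k\<bar> dvd a k))"
    using sk by (auto simp: valid_slopes_def)
  have "(if a k = 0 then edge_source G k (s k) = lower_end G \<Omega> k \<and> edge_target G k (s k) = upper_end G \<Omega> k
        else {edge_source G k (s k), edge_target G k (s k)} = {lower_end G \<Omega> k, upper_end G \<Omega> k})"
    if k: "k \<in> nonloop_edges G" for k
    using sk[of k] ends_source_target[OF k, of "s k"] k by (auto simp: valid_slopes_def arcs_cases)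
  then have 2: "\<forall>k\<in>nonloop_edges G.
        if a k = 0 then edge_source G k (s k) = lower_end G \<Omega> k \<and> edge_target G k (s k) = upper_end G \<Omega> k
        else {edge_source G k (s k), edge_target G k (s k)} = {lower_end G \<Omega> k, upper_end G \<Omega> k}"
    by blast
  have 3: "(\<Prod>k\<in>nonloop_edges G. x_fraction (edge_source G k (s k)) (edge_target G k (s k)) ^ nat \<bar>s k\<bar>)
      = x_monomial (verts G) l"
    using prod_fraction_iff[of "\<lambda>k. edge_source G k (s k)" "\<lambda>k. edge_target G k (s k)" "\<lambda>k. nat \<bar>s k\<bar>" s]
      canonical_imp_admissible[OF s] by (simp add: x_fraction_power_edge admissible_def)
  show "T \<in> tuples G \<Omega> a l"
    unfolding T slope_tuple_def tuples_def mem_Collect_eq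
    by (intro exI[of _ "\<lambda>k. nat \<bar>s k\<bar>"] exI[of _ "\<lambda>k. edge_source G k (s k)"]
        exI[of _ "\<lambda>k. edge_target G k (s k)"] conjI refl 1 2 3)
next
  fix T assume "T \<in> tuples G \<Omega> a l"
  then obtain w u v where T: "T = make_tuple G a w u v"
    and w: "\<forall>k\<in>arcs G. w k > 0 \<and> (a k \<noteq> 0 \<longrightarrow> w k dvd a k)"
    and uv: "\<forall>k\<in>nonloop_edges G.
        if a k = 0 then u k = lower_end G \<Omega> k \<and> v k = upper_end G \<Omega> k
        else {u k, v k} = {lower_end G \<Omega> k, upper_end G \<Omega> k}"
    and prod: "(\<Prod>k\<in>nonloop_edges G. x_fraction (u k) (v k) ^ w k) = x_monomial (verts G) l"
    unfolding tuples_def mem_Collect_eq by (elim exE conjE)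
  note w = bspec[OF w] and uv = bspec[OF uv]
  \<comment> \<open>The sign records whether the tail is the numerator of the fraction. Loops are
    made positive whatever \<open>u\<close> is there, since tuples do not constrain \<open>u\<close>
    on loops.\<close>
  define s where "s = (\<lambda>k\<in>arcs G. if k \<in> loop_edges G \<or> u k = tail G k then int (w k) else - int (w k))"
  have sw: "nat \<bar>s k\<bar> = w k" if "k \<in> arcs G" for k using that by (simp add: s_def)
  have src: "edge_source G k (s k) = u k \<and> edge_target G k (s k) = v k" if k: "k \<in> nonloop_edges G" for k
  proof -
    have "{lower_end G \<Omega> k, upper_end G \<Omega> k} = {tail G k, head G k}"
      by (auto simp: lower_end_def upper_end_def)
    then have "{u k, v k} = {tail G k, head G k}" using uv[OF k] by (simp split: if_splits)
    then have "u k = tail G k \<and> v k = head G k \<or> u k = head G k \<and> v k = tail G k"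
      by (simp add: doubleton_eq_iff)
    moreover have "k \<in> arcs G" "k \<notin> loop_edges G" "tail G k \<noteq> head G k"
      using k by (auto simp: nonloop_edges_def loop_edges_def)
    ultimately show ?thesis using w[of k]
      by (auto simp: s_def edge_source_def edge_target_def)
  qed
  have "x_fraction (u k) (v k) ^ w k = Poly_Mapping.single (edge_monomial G k (s k)) 1"
    if k: "k \<in> nonloop_edges G" for k
    using x_fraction_power_edge[of G k "s k"] src[OF k] sw[of k] k by (simp add: arcs_cases)
  then have "balanced G l s" using prod_fraction_iff[of u v w s] prod by simp
  moreover have "s k \<in> canonical_slopes G \<Omega> a k" if k: "k \<in> arcs G" for k
  proof -
    have "s k \<noteq> 0" "s k dvd int (a k)" using w[OF k] k by (auto simp: s_def)
    moreover have "\<Omega> (edge_source G k (s k)) < \<Omega> (edge_target G k (s k))" if a0: "a k = 0"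
    proof -
      have "k \<in> nonloop_edges G" using k a0 loops_pos[of k] by (auto simp: arcs_cases)
      then show ?thesis using ends_source_target(2)[of k "s k"] src[of k] uv[of k] a0 by simp
    qed
    moreover have "k \<in> loop_edges G \<longrightarrow> s k > 0" using w[OF k] k by (simp add: s_def)
    ultimately show ?thesis by (simp add: canonical_slopes_def valid_slopes_def)
  qed
  ultimately have "s \<in> canonical" by (auto simp: canonical_def s_def)
  moreover have "slope_tuple G a s = T"
    unfolding slope_tuple_def T by (rule make_tuple_cong) (use sw src in auto)
  ultimately show "T \<in> slope_tuple G a ` canonical" by blast
qed

text \<open>An edge with \<open>a k = 0\<close> strictly climbs in the order, so the potential
  \<open>\<Sum>i. \<Omega> i * l i\<close> bounds its slope; every other slope divides \<open>a k\<close>.\<close>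

lemma finite_canonical: "finite canonical"
proof -
  \<comment> \<open>By summation by parts with the order as weight, \<open>B\<close> is the sum of
    the \<open>b k\<close> below, for every canonical \<open>s\<close>. The summand
    \<open>n * a k\<close> absorbs a descent: if \<open>a k > 0\<close>, then
    \<open>\<bar>s k\<bar> \<le> a k\<close> and \<open>d k \<ge> - n\<close>. Hence each
    \<open>b k\<close> is nonnegative and at least \<open>\<bar>s k\<bar>\<close>.\<close>
  define B where "B = (\<Sum>k\<in>arcs G. int (a k) + int n * int (a k)) - (\<Sum>i\<in>verts G. int (\<Omega> i) * l i)"
  have "canonical \<subseteq> PiE (arcs G) (\<lambda>_. {- B..B})"
  proof
    fix s assume s: "s \<in> canonical"
    define d where "d k = int (\<Omega> (edge_target G k (s k))) - int (\<Omega> (edge_source G k (s k)))" for k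
    define b where "b k = int (a k) + (\<bar>s k\<bar> * d k + int n * int (a k))" for k
    have "(\<Sum>i\<in>verts G. int (\<Omega> i) * l i)
        = (\<Sum>k\<in>arcs G. s k * (int (\<Omega> (tail G k)) - int (\<Omega> (head G k))))"
      using s by (intro balanced_sum finite_arcs finite_verts graph) (simp add: canonical_def)
    also have "\<dots> = - (\<Sum>k\<in>arcs G. \<bar>s k\<bar> * d k)"
      unfolding sum_negf[symmetric]
      by (intro sum.cong) (auto simp: d_def edge_source_def edge_target_def abs_if algebra_simps)
    finally have B: "B = sum b (arcs G)"
      by (simp add: B_def b_def sum.distrib)
    have b: "\<bar>s k\<bar> \<le> b k" if k: "k \<in> arcs G" for k
    proof (cases "a k = 0")
      case True
      have "s k \<in> valid_slopes G \<Omega> a k"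
        using canonical_imp_admissible[OF s] k by (simp add: admissible_def)
      then have "d k \<ge> 1" using True by (simp add: valid_slopes_def d_def)
      then have "\<bar>s k\<bar> * 1 \<le> \<bar>s k\<bar> * d k" by (intro mult_left_mono) auto
      then show ?thesis using True by (simp add: b_def)
    next
      case False
      have "s k dvd int (a k)"
        using canonical_imp_admissible[OF s] k by (simp add: admissible_def valid_slopes_def)
      then have sa: "\<bar>s k\<bar> \<le> int (a k)" using False by (simp add: zdvd_imp_le)
      have "d k \<ge> - int n"
        using order_bounds[OF source_vert[OF k, of "s k"]] order_bounds[OF target_vert[OF k, of "s k"]]
        unfolding d_def by linarith
      then have "\<bar>s k\<bar> * d k \<ge> \<bar>s k\<bar> * (- int n)" by (intro mult_left_mono) auto
      moreover have "\<bar>s k\<bar> * int n \<le> int (a k) * int n" using sa by (intro mult_right_mono) auto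
      ultimately show ?thesis using sa by (simp add: b_def mult.commute)
    qed
    have "s k \<in> {- B..B}" if k: "k \<in> arcs G" for k
    proof -
      have "0 \<le> b k'" if "k' \<in> arcs G" for k' using b[OF that] by linarith
      then have "b k \<le> B" unfolding B using k by (intro member_le_sum) auto
      then show ?thesis using b[OF k] by auto
    qed
    then show "s \<in> PiE (arcs G) (\<lambda>_. {- B..B})"
      using s by (auto simp: canonical_def PiE_iff)
  qed
  then show ?thesis by (rule finite_subset) (simp add: finite_PiE)
qed

end

section \<open>The coefficient of the Feynman integral\<close>

text \<open>Only \<open>w = \<bar>j\<bar>\<close> contributes to the power \<open>j\<close>. The
  resulting condition has the shape of \<open>valid_slopes\<close>, with \<open>j > 0\<close> in the
  role of the order condition for exponent 0.\<close>

lemma propagator_nth: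
  "fls_nth (fps_nth propagator b) j
    = (if j \<noteq> 0 \<and> j dvd int b \<and> (b = 0 \<longrightarrow> j > 0) then \<bar>j\<bar> else 0)"
proof (cases "b = 0")
  case False
  have "fls_nth (fps_nth propagator b) j
      = (\<Sum>w | w dvd b. int w * ((if j = int w then 1 else 0) + (if j = - int w then 1 else 0)))"
    using False by (simp add: propagator_def fls_nth_sum algebra_simps eq_neg_iff_add_eq_0)
  also have "\<dots> = (\<Sum>w | w dvd b. if w = nat \<bar>j\<bar> then \<bar>j\<bar> else 0)"
    using False by (intro sum.cong refl) (auto simp: abs_if split: if_splits)
  also have "\<dots> = (if nat \<bar>j\<bar> dvd b then \<bar>j\<bar> else 0)"
    using False by simp
  also have "\<dots> = (if j \<noteq> 0 \<and> j dvd int b then \<bar>j\<bar> else 0)" by auto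
  finally show ?thesis using False by simp
qed (auto simp: propagator_def)

text \<open>Propagators orient an edge by the order of its ends, slopes by its parametrization; the
  two conventions differ by a sign.\<close>

lemma single_diff_eq_edge_monomial:
  "Poly_Mapping.single (lower_end G \<Omega> k) j - Poly_Mapping.single (upper_end G \<Omega> k) j
    = edge_monomial G k (if \<Omega> (tail G k) < \<Omega> (head G k) then j else - j)"
  by (simp add: lower_end_def upper_end_def edge_monomial_def single_uminus)

lemma edge_series_support:
  assumes "k \<in> arcs G" "edge_series G \<Omega> k m \<noteq> 0"
  shows "\<exists>b. snd m = Poly_Mapping.single k b"
proof (rule ccontr)
  assume no: "\<nexists>b. snd m = Poly_Mapping.single k b"
  have "edge_series G \<Omega> k m = 0"
  proof (cases "k \<in> loop_edges G")
    case True
    have "{b. m = (0, Poly_Mapping.single k b)} = {}" using no by auto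
    then show ?thesis using True by (simp add: edge_series_def subst_loop_propagator_def)
  next
    case False
    have "{(j, b). m = (Poly_Mapping.single (lower_end G \<Omega> k) j - Poly_Mapping.single (upper_end G \<Omega> k) j,
        Poly_Mapping.single k b)} = {}" using no by auto
    then show ?thesis using False by (simp add: edge_series_def subst_propagator_def)
  qed
  then show False using assms(2) by simp
qed

context circle_cover_setting
begin

text \<open>All slopes of a loop have the trivial monomial, so the fibre consists of all positive
  divisors of \<open>a k\<close>, and the sum over it is the coefficient of the loop
  propagator.\<close>

lemma edge_series_loop:
  assumes k: "k \<in> loop_edges G"
  shows "edge_series G \<Omega> k (e, Poly_Mapping.single k (a k))
    = (\<Sum>t | t \<in> canonical_slopes G \<Omega> a k \<and> edge_monomial G k t = e. \<bar>t\<bar>)"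
proof (cases "e = 0")
  case True
  have "{b. (e, Poly_Mapping.single k (a k)) = (0, Poly_Mapping.single k b)} = {a k}"
    using True by (auto simp: inj_eq)
  then have "edge_series G \<Omega> k (e, Poly_Mapping.single k (a k)) = fps_nth loop_propagator (a k)"
    using k by (simp add: edge_series_def subst_loop_propagator_def)
  also have "\<dots> = (\<Sum>w | w dvd a k. int w)"
    using loops_pos[OF k] by (simp add: loop_propagator_def)
  also have "\<dots> = (\<Sum>t\<in>int ` {w. w dvd a k}. \<bar>t\<bar>)" by (simp add: sum.reindex)
  also have "int ` {w. w dvd a k} = {t. t \<in> canonical_slopes G \<Omega> a k \<and> edge_monomial G k t = e}"
  proof (intro subset_antisym subsetI)
    fix t assume "t \<in> int ` {w. w dvd a k}"
    then obtain w where "w dvd a k" "t = int w" by auto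
    moreover have "w \<noteq> 0" using calculation loops_pos[OF k] by auto
    ultimately show "t \<in> {t. t \<in> canonical_slopes G \<Omega> a k \<and> edge_monomial G k t = e}"
      using k True loops_pos[OF k] by (simp add: canonical_slopes_def valid_slopes_def edge_monomial_loop)
  next
    fix t assume "t \<in> {t. t \<in> canonical_slopes G \<Omega> a k \<and> edge_monomial G k t = e}"
    then have "t > 0" "t dvd int (a k)" using k by (auto simp: canonical_slopes_def valid_slopes_def)
    then have "nat t dvd a k" "t = int (nat t)" by (simp_all add: nat_dvd_iff)
    then show "t \<in> int ` {w. w dvd a k}" by blast
  qed
  finally show ?thesis .
next
  case False
  then have T: "{t. t \<in> canonical_slopes G \<Omega> a k \<and> edge_monomial G k t = e} = {}"
    using k by (auto simp: edge_monomial_loop)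
  show ?thesis unfolding T using False k by (simp add: edge_series_def subst_loop_propagator_def)
qed

text \<open>At most one slope has the monomial \<open>e\<close>, as the ends are distinct. The sign
  change \<open>\<sigma>\<close> turns the condition of a positive exponent at
  \<open>a k = 0\<close> into the order condition.\<close>

lemma edge_series_nonloop:
  assumes k: "k \<in> nonloop_edges G"
  shows "edge_series G \<Omega> k (e, Poly_Mapping.single k (a k))
    = (\<Sum>t | t \<in> canonical_slopes G \<Omega> a k \<and> edge_monomial G k t = e. \<bar>t\<bar>)"
proof -
  define \<sigma> where "\<sigma> j = (if \<Omega> (tail G k) < \<Omega> (head G k) then j else - j)" for j :: int
  have kl: "k \<notin> loop_edges G" "tail G k \<noteq> head G k"
    using k by (auto simp: nonloop_edges_def loop_edges_def)
  let ?J = "{(j, b). (e, Poly_Mapping.single k (a k)) =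
     (Poly_Mapping.single (lower_end G \<Omega> k) j - Poly_Mapping.single (upper_end G \<Omega> k) j,
      Poly_Mapping.single k b)}"
  let ?T = "{t. t \<in> canonical_slopes G \<Omega> a k \<and> edge_monomial G k t = e}"
  have J: "?J = {(j, b). e = edge_monomial G k (\<sigma> j) \<and> b = a k}"
    by (auto simp: single_diff_eq_edge_monomial \<sigma>_def inj_eq)
  have lhs: "edge_series G \<Omega> k (e, Poly_Mapping.single k (a k))
      = (\<Sum>(j, b)\<in>?J. fls_nth (fps_nth propagator b) j)"
    using kl by (simp add: edge_series_def subst_propagator_def)
  show ?thesis
  proof (cases "\<exists>t. e = edge_monomial G k t")
    case True
    then obtain t where e: "e = edge_monomial G k t" by blast
    have \<sigma>\<sigma>: "\<sigma> (\<sigma> j) = j" for j by (simp add: \<sigma>_def)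
    have inj: "edge_monomial G k t = edge_monomial G k t' \<longleftrightarrow> t = t'" for t t'
      using edge_monomial_inj[OF kl(2)] by blast
    have "?J = {(\<sigma> t, a k)}"
      unfolding J unfolding e inj using \<sigma>\<sigma> by force
    then have "edge_series G \<Omega> k (e, Poly_Mapping.single k (a k)) = fls_nth (fps_nth propagator (a k)) (\<sigma> t)"
      unfolding lhs by simp
    also have "\<dots> = (if t \<in> canonical_slopes G \<Omega> a k then \<bar>t\<bar> else 0)"
      using kl order_inj[of "tail G k" "head G k"]
      by (auto simp: propagator_nth \<sigma>_def canonical_slopes_def valid_slopes_def
          edge_source_def edge_target_def)
    also have "\<dots> = (\<Sum>t\<in>?T. \<bar>t\<bar>)"
    proof -
      have "?T = (if t \<in> canonical_slopes G \<Omega> a k then {t} else {})"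
        unfolding e inj by auto
      then show ?thesis by simp
    qed
    finally show ?thesis .
  next
    case False
    then have "?J = {}" "?T = {}" unfolding J by auto
    then show ?thesis unfolding lhs by (simp only: sum.empty)
  qed
qed

lemma edge_series_eq:
  "k \<in> arcs G \<Longrightarrow> edge_series G \<Omega> k (e, Poly_Mapping.single k (a k))
    = (\<Sum>t | t \<in> canonical_slopes G \<Omega> a k \<and> edge_monomial G k t = e. \<bar>t\<bar>)"
  using edge_series_loop edge_series_nonloop arcs_cases by blast

text \<open>For \<open>a k = 0\<close> a non-loop edge has infinitely many canonical slopes, but a
  fixed monomial leaves finitely many, which permits distributing the product over the sums.\<close>

lemma finite_canonical_fibre:
  assumes "k \<in> arcs G"
  shows "finite {t. t \<in> canonical_slopes G \<Omega> a k \<and> edge_monomial G k t = e}"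
proof (cases "k \<in> loop_edges G")
  case True
  have "{t. t \<in> canonical_slopes G \<Omega> a k \<and> edge_monomial G k t = e} \<subseteq> {t. t dvd int (a k)}"
    by (auto simp: canonical_slopes_def valid_slopes_def)
  moreover have "finite {t. t dvd int (a k)}" using loops_pos[OF True] by simp
  ultimately show ?thesis by (rule finite_subset)
next
  case False
  then have "tail G k \<noteq> head G k" using assms by (simp add: loop_edges_def)
  then have "inj (edge_monomial G k)" by (auto intro: injI edge_monomial_inj)
  then have "finite (edge_monomial G k -` {e})" by (rule finite_vimageI[rotated]) simp
  then show ?thesis by (rule rev_finite_subset) auto
qed

lemma feynman_integral_eq:
  "feynman_integral G \<Omega> l (exponents (arcs G) a) = (\<Sum>s\<in>canonical. \<Prod>k\<in>arcs G. \<bar>s k\<bar>)"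
proof -
  define m where "m = (exponents (verts G) l, exponents (arcs G) a)"
  define mon where "mon s = (\<lambda>k\<in>arcs G. (edge_monomial G k (s k), Poly_Mapping.single k (a k)))" for s
  define F where "F = edge_series G \<Omega>"
  \<comment> \<open>\<open>Ms\<close> contains the contributing choices of one monomial per edge. A
    choice does not fix the slopes of loops, so the canonical functions are grouped by
    \<open>mon\<close>, and \<open>fib M k\<close> holds the slopes compatible with the choice
    \<open>M\<close> at \<open>k\<close>.\<close>
  define Ms where "Ms = {M. M \<in> arcs G \<rightarrow>\<^sub>E UNIV \<and> (\<Sum>k\<in>arcs G. M k) = m \<and> (\<Prod>k\<in>arcs G. F k (M k)) \<noteq> 0}"
  define fib where "fib M k = {t. t \<in> canonical_slopes G \<Omega> a k \<and> edge_monomial G k t = fst (M k)}"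
    for M :: "nat \<Rightarrow> exponent" and k
  \<comment> \<open>The variable q_k occurs only in the factor of edge k, so the total exponent of
    q_k must come from that factor.\<close>
  have snd_eq: "snd (M k) = Poly_Mapping.single k (a k)" if M: "M \<in> Ms" and k: "k \<in> arcs G" for M k
  proof -
    have "\<exists>b. snd (M k') = Poly_Mapping.single k' b" if "k' \<in> arcs G" for k'
      using M that edge_series_support[OF that, of \<Omega> "M k'"] by (auto simp: Ms_def F_def)
    then obtain b where b: "\<And>k'. k' \<in> arcs G \<Longrightarrow> snd (M k') = Poly_Mapping.single k' (b k')" by metis
    have "exponents (arcs G) a = snd (\<Sum>k\<in>arcs G. M k)" using M by (simp add: Ms_def m_def)
    also have "\<dots> = exponents (arcs G) b" by (simp add: snd_sum b exponents_def)
    finally have "Poly_Mapping.lookup (exponents (arcs G) a) k = Poly_Mapping.lookup (exponents (arcs G) b) k"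
      by simp
    then have "a k = b k" using k by (simp add: lookup_exponents)
    then show ?thesis using b[OF k] by simp
  qed
  have term_eq: "(\<Prod>k\<in>arcs G. F k (M k)) = (\<Sum>s | s \<in> canonical \<and> mon s = M. \<Prod>k\<in>arcs G. \<bar>s k\<bar>)"
    if M: "M \<in> Ms" for M
  proof -
    have Mk: "M k = (fst (M k), Poly_Mapping.single k (a k))" if "k \<in> arcs G" for k
      using snd_eq[OF M that] by (metis prod.collapse)
    have "(\<Prod>k\<in>arcs G. F k (M k)) = (\<Prod>k\<in>arcs G. \<Sum>t\<in>fib M k. \<bar>t\<bar>)"
    proof (intro prod.cong refl)
      fix k assume k: "k \<in> arcs G"
      show "F k (M k) = (\<Sum>t\<in>fib M k. \<bar>t\<bar>)"
        using edge_series_eq[OF k, of "fst (M k)"] Mk[OF k] by (simp add: F_def fib_def)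
    qed
    also have "\<dots> = (\<Sum>s\<in>PiE (arcs G) (fib M). \<Prod>k\<in>arcs G. \<bar>s k\<bar>)"
      by (rule prod_sum_PiE) (auto simp: fib_def finite_canonical_fibre)
    also have "PiE (arcs G) (fib M) = {s. s \<in> canonical \<and> mon s = M}"
    proof (intro subset_antisym subsetI)
      fix s assume s: "s \<in> PiE (arcs G) (fib M)"
      have "(\<Sum>k\<in>arcs G. edge_monomial G k (s k)) = (\<Sum>k\<in>arcs G. fst (M k))"
        using s by (intro sum.cong) (auto simp: fib_def PiE_iff)
      also have "\<dots> = exponents (verts G) l" using M by (simp add: Ms_def m_def flip: fst_sum)
      finally have "balanced G l s" by (simp add: balanced_iff)
      then have "s \<in> canonical" using s by (auto simp: canonical_def fib_def PiE_iff)
      moreover have "mon s = M"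
      proof
        fix k
        show "mon s k = M k"
        proof (cases "k \<in> arcs G")
          case True
          then show ?thesis using s Mk[OF True] by (auto simp: mon_def fib_def PiE_iff)
        next
          case False
          then show ?thesis using M by (auto simp: mon_def Ms_def PiE_iff extensional_def)
        qed
      qed
      ultimately show "s \<in> {s. s \<in> canonical \<and> mon s = M}" by simp
    next
      fix s assume "s \<in> {s. s \<in> canonical \<and> mon s = M}"
      then show "s \<in> PiE (arcs G) (fib M)"
        by (auto simp: canonical_def fib_def mon_def PiE_iff)
    qed
    finally show ?thesis .
  qed
  have mon_Ms: "mon s \<in> Ms" if s: "s \<in> canonical" for s
  proof -
    have "(\<Sum>k\<in>arcs G. edge_monomial G k (s k)) = exponents (verts G) l"
      using s by (simp add: canonical_def balanced_iff)
    then have "(\<Sum>k\<in>arcs G. mon s k) = m"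
      by (simp add: mon_def m_def prod_eq_iff fst_sum snd_sum exponents_def)
    moreover have "F k (mon s k) \<noteq> 0" if k: "k \<in> arcs G" for k
    proof -
      let ?A = "{t. t \<in> canonical_slopes G \<Omega> a k \<and> edge_monomial G k t = edge_monomial G k (s k)}"
      have sk: "s k \<in> ?A" using s k by (auto simp: canonical_def)
      \<comment> \<open>The summands are nonnegative, so the nonzero contribution of
        \<open>s k\<close> cannot cancel.\<close>
      then have "\<bar>s k\<bar> \<le> (\<Sum>t\<in>?A. \<bar>t\<bar>)"
        using finite_canonical_fibre[OF k] by (intro member_le_sum) auto
      moreover have "s k \<noteq> 0" using sk by (simp add: canonical_slopes_def valid_slopes_def)
      ultimately show ?thesis using k by (simp add: F_def mon_def edge_series_eq)
    qed
    ultimately show ?thesis by (simp add: Ms_def) (simp add: mon_def)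
  qed
  have "Ms = mon ` canonical"
  proof (intro subset_antisym subsetI)
    fix M assume M: "M \<in> Ms"
    then have "(\<Prod>k\<in>arcs G. F k (M k)) \<noteq> 0" unfolding Ms_def by blast
    then have "(\<Sum>s | s \<in> canonical \<and> mon s = M. \<Prod>k\<in>arcs G. \<bar>s k\<bar>) \<noteq> 0"
      by (simp only: term_eq[OF M] not_False_eq_True)
    then have "{s. s \<in> canonical \<and> mon s = M} \<noteq> {}" by (metis sum.empty)
    then show "M \<in> mon ` canonical" by blast
  qed (use mon_Ms in auto)
  \<comment> \<open>Finiteness matters: over an infinite index set the sum in
    \<open>series_prod\<close> would be 0 by convention.\<close>
  then have fin: "finite Ms" using finite_canonical by simp
  have "feynman_integral G \<Omega> l (exponents (arcs G) a) = (\<Sum>M\<in>Ms. \<Prod>k\<in>arcs G. F k (M k))"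
    by (simp add: feynman_integral_def series_prod_def Ms_def F_def m_def)
  also have "\<dots> = (\<Sum>M\<in>Ms. \<Sum>s | s \<in> canonical \<and> mon s = M. \<Prod>k\<in>arcs G. \<bar>s k\<bar>)"
    by (rule sum.cong[OF refl term_eq])
  also have "\<dots> = (\<Sum>s\<in>canonical. \<Prod>k\<in>arcs G. \<bar>s k\<bar>)"
    by (rule sum.group[OF finite_canonical fin]) (use mon_Ms in auto)
  finally show ?thesis .
qed

end

section \<open>Isomorphism classes and surjectivity\<close>

text \<open>Since \<open>R\<close> is the kernel of \<open>f\<close> on \<open>S\<close>, the
  function \<open>f\<close> is constant on classes and separates them. With \<open>f\<close> the
  canonical slopes, this also supplies the equivalence properties of isomorphism.\<close>

lemma quotient_kernel:
  assumes "\<And>x y. x \<in> S \<Longrightarrow> y \<in> S \<Longrightarrow> (x, y) \<in> R \<longleftrightarrow> f x = f y" "R \<subseteq> S \<times> S"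
  shows "bij_betw (\<lambda>c. the_elem (f ` c)) (S // R) (f ` S)"
    and "c \<in> S // R \<Longrightarrow> x \<in> c \<Longrightarrow> x \<in> S \<and> the_elem (f ` c) = f x"
    and "c \<in> S // R \<Longrightarrow> \<exists>x. x \<in> c"
proof -
  have cls: "R `` {x} = {y \<in> S. f y = f x}" if "x \<in> S" for x
    using assms that by fastforce
  have el: "x \<in> S \<and> f ` c = {f x}" if "c \<in> S // R" "x \<in> c" for c x
  proof -
    obtain y where y: "c = R `` {y}" "y \<in> S" using \<open>c \<in> S // R\<close> by (rule quotientE)
    show ?thesis using \<open>x \<in> c\<close> unfolding y(1) cls[OF y(2)] by auto
  qed
  have ne: "\<exists>x. x \<in> c" if "c \<in> S // R" for c
    using that cls by (auto elim!: quotientE)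
  show "c \<in> S // R \<Longrightarrow> x \<in> c \<Longrightarrow> x \<in> S \<and> the_elem (f ` c) = f x" using el[of c x] by simp
  show "c \<in> S // R \<Longrightarrow> \<exists>x. x \<in> c" by (rule ne)
  show "bij_betw (\<lambda>c. the_elem (f ` c)) (S // R) (f ` S)"
  proof (rule bij_betw_imageI)
    show "inj_on (\<lambda>c. the_elem (f ` c)) (S // R)"
    proof (rule inj_onI)
      fix c d assume cd: "c \<in> S // R" "d \<in> S // R" and eq: "the_elem (f ` c) = the_elem (f ` d)"
      obtain x y where "x \<in> S" "c = R `` {x}" "y \<in> S" "d = R `` {y}"
        using cd by (auto elim!: quotientE)
      moreover have "x \<in> c" "y \<in> d" using calculation cls by auto
      ultimately show "c = d" using el[OF cd(1), of x] el[OF cd(2), of y] eq cls by simp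
    qed
    show "(\<lambda>c. the_elem (f ` c)) ` (S // R) = f ` S"
    proof (intro subset_antisym subsetI)
      fix z assume "z \<in> (\<lambda>c. the_elem (f ` c)) ` (S // R)"
      then obtain c where c: "c \<in> S // R" "z = the_elem (f ` c)" by auto
      then obtain x where "x \<in> c" using ne by blast
      then show "z \<in> f ` S" using el[OF c(1)] c(2) by auto
    next
      fix z assume "z \<in> f ` S"
      then obtain x where x: "x \<in> S" "z = f x" by auto
      have c: "R `` {x} \<in> S // R" using x(1) by (rule quotientI)
      have "x \<in> R `` {x}" using x(1) cls[OF x(1)] by simp
      then have "z = the_elem (f ` (R `` {x}))" using el[OF c] x(2) by simp
      then show "z \<in> (\<lambda>c. the_elem (f ` c)) ` (S // R)" using c by (rule image_eqI)
    qed
  qed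
qed

context circle_cover_setting
begin

lemma iso_rel_leaky_iff:
  assumes "C \<in> leaky_maps L p G \<Omega> a l" "D \<in> leaky_maps L p G \<Omega> a l"
  shows "(C, D) \<in> iso_rel G (leaky_maps L p G \<Omega> a l) \<longleftrightarrow> canonicalize (slopes C) = canonicalize (slopes D)"
  using assms isomorphic_imp_same_slopes same_slopes_imp_isomorphic
  by (auto simp: iso_rel_def canonicalize_eq_iff)

lemma canonical_slopes_image:
  "(\<lambda>C. canonicalize (slopes C)) ` leaky_maps L p G \<Omega> a l = canonical"
proof (intro subset_antisym subsetI)
  fix s assume s: "s \<in> canonical"
  note std = standard_cover[OF canonical_imp_admissible[OF s]]
  have "canonicalize (slopes (standard_cover s)) = canonicalize s"
    using std(2) by (simp add: canonicalize_eq_iff same_up_to_loops_def)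
  then show "s \<in> (\<lambda>C. canonicalize (slopes C)) ` leaky_maps L p G \<Omega> a l"
    using std(1) canonicalize_canonical[OF s] by (metis image_eqI)
qed (auto intro: canonicalize_admissible leaky_maps_admissible)

lemma leaky_maps_count:
  defines "S \<equiv> leaky_maps L p G \<Omega> a l"
  shows "\<exists>\<Phi>. bij_betw \<Phi> (iso_classes G S) (tuples G \<Omega> a l) \<and>
      (\<forall>c\<in>iso_classes G S. \<forall>C\<in>c. \<Phi> c = cover_tuple L G a C)"
    and "finite (iso_classes G S)"
    and "int (weighted_count L G S) = feynman_integral G \<Omega> l (exponents (arcs G) a)"
proof -
  define f where "f C = canonicalize (slopes C)" for C
  define cl where "cl c = the_elem (f ` c)" for c
  have ker: "\<And>C D. C \<in> S \<Longrightarrow> D \<in> S \<Longrightarrow> (C, D) \<in> iso_rel G S \<longleftrightarrow> f C = f D"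
    unfolding S_def f_def by (rule iso_rel_leaky_iff)
  have sub: "iso_rel G S \<subseteq> S \<times> S" by (auto simp: iso_rel_def)
  have img: "f ` S = canonical"
    unfolding f_def S_def by (rule canonical_slopes_image)
  have bij: "bij_betw cl (iso_classes G S) canonical"
    using quotient_kernel(1)[of S "iso_rel G S" f] ker sub img by (simp add: iso_classes_def cl_def[abs_def])
  have el: "C \<in> S \<and> cl c = f C" if "c \<in> iso_classes G S" "C \<in> c" for c C
    using quotient_kernel(2)[of S "iso_rel G S" f, OF ker sub] that by (simp add: iso_classes_def cl_def)
  have ne: "\<exists>C. C \<in> c" if "c \<in> iso_classes G S" for c
    using quotient_kernel(3)[of S "iso_rel G S" f, OF ker sub] that by (simp add: iso_classes_def)
  have "bij_betw (slope_tuple G a) canonical (tuples G \<Omega> a l)"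
    using inj_on_slope_tuple by (simp add: tuples_eq bij_betw_def)
  then have "bij_betw (slope_tuple G a \<circ> cl) (iso_classes G S) (tuples G \<Omega> a l)"
    using bij by (rule bij_betw_trans[rotated])
  moreover have "(slope_tuple G a \<circ> cl) c = cover_tuple L G a C" if "c \<in> iso_classes G S" "C \<in> c" for c C
    using el[OF that] by (simp add: cover_tuple_eq f_def slope_tuple_canonicalize)
  ultimately show "\<exists>\<Phi>. bij_betw \<Phi> (iso_classes G S) (tuples G \<Omega> a l) \<and>
      (\<forall>c\<in>iso_classes G S. \<forall>C\<in>c. \<Phi> c = cover_tuple L G a C)" by blast
  show "finite (iso_classes G S)" using bij_betw_finite[OF bij] finite_canonical by simp
  define W where "W s = (\<Prod>k\<in>arcs G. nat \<bar>s k\<bar>)" for s :: "nat \<Rightarrow> int"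
  have "the_elem ((\<lambda>C. \<Prod>k\<in>arcs G. expansion L G C k) ` c) = W (cl c)" if c: "c \<in> iso_classes G S" for c
  proof -
    \<comment> \<open>Canonicalization changes only signs on loops, so the weight is constant on the
      class.\<close>
    have "(\<Prod>k\<in>arcs G. expansion L G C k) = W (cl c)" if "C \<in> c" for C
      using el[OF c that] by (auto simp: W_def f_def canonicalize_def expansion_eq intro!: prod.cong)
    then have "(\<lambda>C. \<Prod>k\<in>arcs G. expansion L G C k) ` c = {W (cl c)}" using ne[OF c] by auto
    then show ?thesis by simp
  qed
  then have "weighted_count L G S = (\<Sum>c\<in>iso_classes G S. W (cl c))" by (simp add: weighted_count_def)
  also have "\<dots> = sum W canonical" by (rule sum.reindex_bij_betw[OF bij])
  finally show "int (weighted_count L G S) = feynman_integral G \<Omega> l (exponents (arcs G) a)"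
    by (simp add: feynman_integral_eq W_def)
qed

text \<open>The left-hand side of \<open>pos_deg\<close> is the number of preimages of \<open>y\<close> in the edge, counted with the
  expansion factor; summed over all edges it is the degree over the arc of \<open>y\<close>.\<close>

lemma edge_hits:
  assumes C: "C \<in> leaky_maps L p G \<Omega> a l" and k: "k \<in> arcs G"
    and y: "X 0 \<le> y" "y < X 0 + L"
    and pos_deg: "int (a k) + slopes C k * (of_bool (pos (tail G k) \<le> y) - of_bool (pos (head G k) \<le> y)) > 0"
  shows "arc_param L y \<in> cover_map C ` points G (edge_length C)"
proof -
  define m where "m = slopes C k"
  define u where "u = edge_source G k m"
  define v where "v = edge_target G k m"
  let ?len = "edge_length C k"
  have m0: "m \<noteq> 0" and len: "?len > 0"
    using leaky_maps_edge[OF C k] by (simp_all add: m_def)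
  have mdvd: "m dvd int (a k)" using leaky_maps_length(1)[OF C k] by (simp add: m_def valid_slopes_def)
  then obtain d where d: "int (a k) = \<bar>m\<bar> * d" by (metis abs_dvd_iff dvdE)
  have "0 \<le> \<bar>m\<bar> * d" by (simp flip: d)
  then have d0: "d \<ge> 0" using m0 by (simp add: zero_le_mult_iff)
  have "real (a k) = of_int \<bar>m\<bar> * of_int d" using arg_cong[OF d, of real_of_int] by simp
  then have length: "\<bar>m\<bar> * ?len = pos v - pos u + L * d"
    using leaky_maps_length(2)[OF C k] m0
    by (simp add: covering_length_def m_def u_def v_def)
  have "m * (of_bool (pos (tail G k) \<le> y) - of_bool (pos (head G k) \<le> y))
      = \<bar>m\<bar> * (of_bool (pos u \<le> y) - of_bool (pos v \<le> y))"
    by (auto simp: u_def v_def edge_source_def edge_target_def)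
  then have "\<bar>m\<bar> * (d + of_bool (pos u \<le> y) - of_bool (pos v \<le> y)) > 0"
    using pos_deg d by (simp add: m_def algebra_simps)
  then have deg: "d + of_bool (pos u \<le> y) - of_bool (pos v \<le> y) > 0"
    using m0 by (simp add: zero_less_mult_iff)
  have uv: "X 0 < pos u" "pos u < X 0 + L" "X 0 < pos v" "pos v < X 0 + L"
    using pos_bounds source_vert[OF k] target_vert[OF k] by (auto simp: u_def v_def)
  \<comment> \<open>The lifted path climbs from \<open>pos u\<close> to
    \<open>pos v + L * d\<close>. The first lift of \<open>y\<close> not below \<open>pos u\<close>
    is \<open>y\<close> itself or \<open>y + L\<close>, and a positive count means that it is
    reached in time.\<close>
  obtain N :: int where N: "pos u \<le> y + L * N" "y + L * N \<le> pos v + L * d"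
  proof (cases "pos u \<le> y")
    case True
    have "y \<le> pos v + L * d"
    proof (cases "pos v \<le> y")
      case pv: True
      then have "L * 1 \<le> L * d" using deg True L by (intro mult_left_mono) auto
      then show ?thesis using uv y by linarith
    next
      case False
      then show ?thesis using L d0 by (smt (verit) mult_nonneg_nonneg of_int_nonneg)
    qed
    then show ?thesis using True that[of 0] by simp
  next
    case False
    then have d1: "d \<ge> 1 + of_bool (pos v \<le> y)" using deg by simp
    have "y + L \<le> pos v + L * d"
    proof (cases "pos v \<le> y")
      case True
      then have "L * 2 \<le> L * d" using d1 L by (intro mult_left_mono) auto
      then show ?thesis using uv y by linarith
    next
      case nv: False
      then have "L * 1 \<le> L * d" using d1 L by (intro mult_left_mono) auto
      then show ?thesis using nv by linarith
    qed
    then show ?thesis using uv y that[of 1] by simp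
  qed
  \<comment> \<open>The time \<open>t'\<close> runs from the source \<open>u\<close>;
    \<open>t\<close> converts it to the parametrization from the tail.\<close>
  define t' where "t' = (y + L * N - pos u) / \<bar>m\<bar>"
  have t'm: "\<bar>m\<bar> * t' = y + L * N - pos u" using m0 by (simp add: t'_def)
  have t'0: "0 \<le> t'" using N(1) by (simp add: t'_def)
  have "\<bar>m\<bar> * t' \<le> \<bar>m\<bar> * ?len" unfolding t'm length using N(2) by simp
  then have t'1: "t' \<le> ?len" using m0 by (simp add: mult_le_cancel_left)
  define t where "t = (if m > 0 then t' else ?len - t')"
  have t: "t \<in> {0..?len}" using t'0 t'1 by (auto simp: t_def)
  have "pos (tail G k) + m * t = y + L * (if m > 0 then N else N - d)"
  proof (cases "m > 0")
    case True
    then show ?thesis using t'm by (simp add: t_def u_def edge_source_def)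
  next
    case False
    then have "m * t = - (\<bar>m\<bar> * ?len) + \<bar>m\<bar> * t'" by (simp add: t_def algebra_simps)
    also have "\<dots> = - (pos v - pos u + L * d) + (y + L * N - pos u)" by (simp only: t'm length)
    finally have "m * t = y + L * (N - d) - pos v" by (simp add: algebra_simps)
    then show ?thesis using False by (simp add: v_def edge_target_def)
  qed
  then have "arc_param L (pos (tail G k) + m * t) = arc_param L y"
    using arc_param_shift[OF L, of y "if m > 0 then N else N - d"] by simp
  then have "arc_param L y = cover_map C (edge_point G (edge_length C) k t)"
    using leaky_maps_parametrization[OF C k t] by (simp add: m_def)
  moreover have "edge_point G (edge_length C) k t \<in> points G (edge_length C)"
    using t k by (auto simp: edge_point_def points_def tail_vert head_vert)
  ultimately show ?thesis by blast
qed

text \<open>Over the arc after p_j the weighted preimage counts of the edges add up to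
  \<open>arc_degree\<close>, by summation by parts with the indicator of the vertices up to place
  \<open>j\<close>. A positive sum has a positive term, and that edge hits the given point.\<close>

lemma leaky_map_surjective:
  assumes C: "C \<in> leaky_maps L p G \<Omega> a l" and deg: "\<And>j. j < n \<Longrightarrow> arc_degree G \<Omega> a l j > 0"
    and n: "n > 0"
  shows "cover_map C ` points G (edge_length C) = circle L"
proof
  show "cover_map C ` points G (edge_length C) \<subseteq> circle L" using C by (simp add: leaky_maps_def)
  show "circle L \<subseteq> cover_map C ` points G (edge_length C)"
  proof
    fix z assume "z \<in> circle L"
    then obtain y where y: "X 0 \<le> y" "y < X 0 + L" and z: "z = arc_param L y"
      using circle_arc_paramE[OF L] by metis
    define j where "j = Max {j. j \<le> n \<and> X j \<le> y}"
    have "j \<in> {j. j \<le> n \<and> X j \<le> y}" unfolding j_def using y by (intro Max_in) auto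
    then have j: "j \<le> n" "X j \<le> y" by auto
    have jmax: "i \<le> j" if "i \<le> n" "X i \<le> y" for i
      unfolding j_def using that by (intro Max_ge) auto
    have pos_le: "pos i \<le> y \<longleftrightarrow> \<Omega> i \<le> j" if "i \<in> verts G" for i
      using order_bounds[OF that] jmax[of "\<Omega> i"] X_le_iff[of "\<Omega> i" j] j by (auto simp: pos_def)
    have bal: "balanced G l (slopes C)" using leaky_maps_admissible[OF C] by (simp add: admissible_def)
    note bsum = balanced_sum[OF finite_arcs finite_verts graph bal]
    have lsum: "(\<Sum>i | i \<in> verts G \<and> \<Omega> i \<le> j. l i)
        = (\<Sum>k\<in>arcs G. slopes C k * (of_bool (pos (tail G k) \<le> y) - of_bool (pos (head G k) \<le> y)))"
    proof -
      have "(\<Sum>i | i \<in> verts G \<and> \<Omega> i \<le> j. l i) = (\<Sum>i\<in>verts G. of_bool (\<Omega> i \<le> j) * l i)"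
        by (simp add: sum.inter_filter of_bool_def if_distrib[of "\<lambda>x. x * _"] cong: if_cong)
      also have "\<dots> = (\<Sum>k\<in>arcs G. slopes C k * (of_bool (\<Omega> (tail G k) \<le> j) - of_bool (\<Omega> (head G k) \<le> j)))"
        by (rule bsum)
      finally show ?thesis by (simp add: pos_le tail_vert head_vert)
    qed
    \<comment> \<open>For \<open>j = n\<close> the arc leads back to p_0, over which no vertex lies;
      as the leaks add up to 0, its degree is that of the arc with \<open>j = 0\<close>.\<close>
    have "arc_degree G \<Omega> a l j > 0"
    proof (cases "j < n")
      case False
      then have "{i. i \<in> verts G \<and> \<Omega> i \<le> j} = verts G" using order_bounds j by fastforce
      moreover have "(\<Sum>i | i \<in> verts G \<and> \<Omega> i \<le> 0. l i) = 0"
        by (intro sum.neutral) (use order_bounds in fastforce)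
      moreover have "sum l (verts G) = 0" using bsum[of "\<lambda>_. 1"] by simp
      ultimately show ?thesis using deg[of 0] n by (simp add: arc_degree_def)
    qed (use deg in simp)
    then have "(\<Sum>k\<in>arcs G. int (a k) + slopes C k *
        (of_bool (pos (tail G k) \<le> y) - of_bool (pos (head G k) \<le> y))) > 0"
      by (simp add: arc_degree_def lsum sum.distrib)
    then obtain k where "k \<in> arcs G" "int (a k) + slopes C k *
        (of_bool (pos (tail G k) \<le> y) - of_bool (pos (head G k) \<le> y)) > 0"
      by (meson not_less sum_nonpos)
    then show "z \<in> cover_map C ` points G (edge_length C)"
      unfolding z using edge_hits[OF C _ y] by blast
  qed
qed

text \<open>Without tuples there are no canonical slopes, hence no leaky maps, and both sets are
  empty; otherwise positive degrees make every leaky map surjective.\<close>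

lemma graph_covers_eq_leaky_maps:
  assumes "tuples G \<Omega> a l = {} \<or> (\<forall>j<n. arc_degree G \<Omega> a l j > 0)" "n > 0"
  shows "graph_covers L p G \<Omega> a l = leaky_maps L p G \<Omega> a l"
proof (cases "tuples G \<Omega> a l = {}")
  case True
  then have "leaky_maps L p G \<Omega> a l = {}" using tuples_eq canonical_slopes_image by blast
  then show ?thesis by (auto simp: graph_covers_def)
next
  case False
  then show ?thesis using assms leaky_map_surjective by (auto simp: graph_covers_def)
qed

end

theorem theorem2p23:
  fixes G :: "(nat, nat) pre_digraph" and n s r :: nat
    and \<Omega> :: "nat \<Rightarrow> nat" and a :: "nat \<Rightarrow> nat" and l :: "nat \<Rightarrow> int"
    and L :: real and p :: "nat \<Rightarrow> complex"
  assumes "feynman_graph n s r G"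
    and "\<Omega> permutes {1..n}"
    and "\<forall>k\<in>{1..s}. a k > 0"
    and "L > 0"
    and "cyclically_ordered L n p"
  shows "(tuples G \<Omega> a l = {} \<or> (\<forall>j<n. arc_degree G \<Omega> a l j > 0) \<longrightarrow>
           (\<exists>\<Phi>. bij_betw \<Phi> (iso_classes G (graph_covers L p G \<Omega> a l)) (tuples G \<Omega> a l) \<and>
             (\<forall>c\<in>iso_classes G (graph_covers L p G \<Omega> a l). \<forall>C\<in>c. \<Phi> c = cover_tuple L G a C)) \<and>
           finite (iso_classes G (graph_covers L p G \<Omega> a l)) \<and>
           int (weighted_count L G (graph_covers L p G \<Omega> a l))
             = feynman_integral G \<Omega> l (exponents {1..r} a))
       \<and> (\<exists>\<Phi>. bij_betw \<Phi> (iso_classes G (leaky_maps L p G \<Omega> a l)) (tuples G \<Omega> a l) \<and>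
             (\<forall>c\<in>iso_classes G (leaky_maps L p G \<Omega> a l). \<forall>C\<in>c. \<Phi> c = cover_tuple L G a C))
       \<and> finite (iso_classes G (leaky_maps L p G \<Omega> a l))
       \<and> int (weighted_count L G (leaky_maps L p G \<Omega> a l))
           = feynman_integral G \<Omega> l (exponents {1..r} a)"
proof -
  obtain X where "\<forall>j<n. X j < X (Suc j)" "X n < X 0 + L" "\<forall>j\<le>n. p j = arc_param L (X j)"
    using assms(5) by (auto simp: cyclically_ordered_def)
  then interpret circle_cover_setting G n \<Omega> a l L p X
    using assms by unfold_locales (auto simp: feynman_graph_def wf_digraph_def)
  have "n > 0" and arcs: "arcs G = {1..r}" using assms(1) by (auto simp: feynman_graph_def)
  then have "tuples G \<Omega> a l = {} \<or> (\<forall>j<n. arc_degree G \<Omega> a l j > 0) \<Longrightarrow>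
      graph_covers L p G \<Omega> a l = leaky_maps L p G \<Omega> a l"
    using graph_covers_eq_leaky_maps by blast
  then show ?thesis using leaky_maps_count unfolding arcs by simp
qed

end
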